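(* Let $-d=d_Kf^2\equiv1\pmod 3$ be a negative discriminant, $K=\mathbb{Q}(\sqrt{-d})$, $(3)=\wp_3\wp_3'$, and suppose the Artin symbol $\tau_3=\left(\frac{\Sigma_{\wp_3'^2}\Omega_f/K}{\wp_3}\right)$ has order $n\ge2$ in $\mathrm{Gal}(\Sigma_{\wp_3'^2}\Omega_f/K)$. Then $n$ is the smallest positive integer for which $$\wp_3^n=\left(\frac{x+y\sqrt{-d}}{2}\right),\quad \frac{x+y\sqrt{-d}}{2}\in\mathsf{R}_{-d},\quad x\equiv\pm1\pmod 9,$$ with $\alpha=\frac{x+y\sqrt{-d}}{2}\equiv\pm1\pmod{\wp_3'^2}$.
   Context: $d_K$ is the discriminant of $K$, $\mathsf{R}_{-d}$ the order of discriminant $-d$ (conductor $f$) in the ring of integers of $K$, $x,y\in\mathbb{Z}$; $(3)=\wp_3\wp_3'$ is the factorization of $3$ into conjugate prime ideals of $K$. $\Omega_f$ is the ring class field of $K$ of conductor $f$, $\Sigma_{\wp_3'^2}$ the ray class field of $K$ of conductor $\wp_3'^2$. (The order $n$ of $\tau_3$ equals the minimal period of the corresponding periodic points of the algebraic function defined by $w^3+(-z^3+6z^2-6z-1)w^2+(z^3-3z^2+3z+1)w-z^3=0$.) *)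

theory Defs
  imports
    "HOL-Algebra.Algebra"
    "HOL-Algebra.Algebraic_Closure_Type"
    "HOL-Number_Theory.Cong"
    Complex_Main
begin

text \<open>All number fields are subfields of the complex numbers.\<close>

abbreviation CC :: "complex ring"
  where "CC \<equiv> ring_of_type_algebra"

definition ring_of_ints :: "complex set \<Rightarrow> complex ring"
  where "ring_of_ints K = CC\<lparr>carrier := {x \<in> K. algebraic_int x}\<rparr>"

definition nonzero_primes :: "complex set \<Rightarrow> complex set set"
  where "nonzero_primes K = {p. primeideal p (ring_of_ints K) \<and> p \<noteq> {0}}"

definition ideal_norm :: "complex set \<Rightarrow> complex set \<Rightarrow> nat"
  where "ideal_norm K I = card (carrier (ring_of_ints K Quot I))"

definition comaximal :: "complex set \<Rightarrow> complex set \<Rightarrow> complex set \<Rightarrow> bool"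
  where "comaximal K I J \<longleftrightarrow> I <+>\<^bsub>ring_of_ints K\<^esub> J = carrier (ring_of_ints K)"

definition quadratic_field :: "int \<Rightarrow> complex set"
  where "quadratic_field D = generate_field CC {csqrt (of_int D)}"

text \<open>
  For an imaginary quadratic field \<open>K\<close> the two embeddings into the complex numbers are the
  inclusion and complex conjugation, so this is \<open>(det (\<sigma>\<^sub>i \<omega>\<^sub>j))\<^sup>2\<close> for an integral basis
  \<open>\<omega>\<^sub>1, \<omega>\<^sub>2\<close>.
\<close>
definition imag_quadratic_disc :: "complex set \<Rightarrow> int \<Rightarrow> bool"
  where "imag_quadratic_disc K D \<longleftrightarrow>
    (\<exists>w1 w2. bij_betw (\<lambda>(a :: int, b :: int). of_int a * w1 + of_int b * w2)
                UNIV (carrier (ring_of_ints K)) \<and>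
             of_int D = (w1 * cnj w2 - w2 * cnj w1)\<^sup>2)"

definition quadratic_order :: "complex set \<Rightarrow> nat \<Rightarrow> complex set"
  where "quadratic_order K f =
    {of_int a + of_nat f * w | a w. w \<in> carrier (ring_of_ints K)}"


subsection \<open>Galois groups and Artin symbols\<close>

definition Gal :: "complex set \<Rightarrow> complex set \<Rightarrow> (complex \<Rightarrow> complex) monoid"
  where "Gal K L = (BijGroup L)\<lparr>carrier :=
    {\<sigma> \<in> Bij L. \<sigma> \<in> ring_hom (CC\<lparr>carrier := L\<rparr>) (CC\<lparr>carrier := L\<rparr>) \<and> (\<forall>x\<in>K. \<sigma> x = x)}\<rparr>"

definition galois_extension :: "complex set \<Rightarrow> complex set \<Rightarrow> bool"
  where "galois_extension K L \<longleftrightarrow>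
    subfield K CC \<and> subfield L CC \<and> K \<subseteq> L \<and> ring.finite_dimension CC K L \<and>
    {x \<in> L. \<forall>\<sigma>\<in>carrier (Gal K L). \<sigma> x = x} = K"

definition abelian_extension :: "complex set \<Rightarrow> complex set \<Rightarrow> bool"
  where "abelian_extension K L \<longleftrightarrow> galois_extension K L \<and> comm_group (Gal K L)"

definition compositum :: "complex set \<Rightarrow> complex set \<Rightarrow> complex set"
  where "compositum L M = generate_field CC (L \<union> M)"

definition primes_above :: "complex set \<Rightarrow> complex set \<Rightarrow> complex set \<Rightarrow> complex set set"
  where "primes_above K L p = {P \<in> nonzero_primes L. P \<inter> K = p}"

definition ramification_index :: "complex set \<Rightarrow> complex set \<Rightarrow> complex set \<Rightarrow> nat"
  where "ramification_index L p P =
    (GREATEST e. genideal (ring_of_ints L) p \<subseteq> P [^]\<^bsub>ideals_set (ring_of_ints L)\<^esub> e)"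

definition unramified :: "complex set \<Rightarrow> complex set \<Rightarrow> complex set \<Rightarrow> bool"
  where "unramified K L p \<longleftrightarrow> (\<forall>P\<in>primes_above K L p. ramification_index L p P = 1)"

definition frobenius_at ::
    "complex set \<Rightarrow> complex set \<Rightarrow> complex set \<Rightarrow> complex set \<Rightarrow> (complex \<Rightarrow> complex) \<Rightarrow> bool"
  where "frobenius_at K L p P \<sigma> \<longleftrightarrow>
    \<sigma> \<in> carrier (Gal K L) \<and> (\<forall>a\<in>carrier (ring_of_ints L). \<sigma> a - a ^ ideal_norm K p \<in> P)"

text \<open>
  \<open>is_artin_symbol K L p \<sigma>\<close> says that \<open>\<sigma>\<close> is the Artin symbol of \<open>p\<close> in the abelian extension
  \<open>L\<close> of \<open>K\<close>: for each prime \<open>P\<close> of \<open>L\<close> above \<open>p\<close>, it is the unique element of the Galois group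
  with \<open>\<sigma> a \<equiv> a ^ N(p)\<close> modulo \<open>P\<close> for all integers \<open>a\<close> of \<open>L\<close>.
\<close>
definition is_artin_symbol ::
    "complex set \<Rightarrow> complex set \<Rightarrow> complex set \<Rightarrow> (complex \<Rightarrow> complex) \<Rightarrow> bool"
  where "is_artin_symbol K L p \<sigma> \<longleftrightarrow>
    \<sigma> \<in> carrier (Gal K L) \<and>
    (\<forall>P\<in>primes_above K L p. \<forall>\<rho>. frobenius_at K L p P \<rho> \<longleftrightarrow> \<rho> = \<sigma>)"


subsection \<open>Class fields\<close>

definition fractional_ideal :: "complex set \<Rightarrow> complex set \<Rightarrow> bool"
  where "fractional_ideal K I \<longleftrightarrow>
    I \<subseteq> K \<and> I \<noteq> {0} \<and>
    (\<exists>c\<in>carrier (ring_of_ints K). c \<noteq> 0 \<and> ideal ((\<lambda>x. c * x) ` I) (ring_of_ints K))"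

text \<open>
  The group of fractional ideals prime to the integral ideal \<open>m\<close>, that is, of the quotients of
  nonzero integral ideals prime to \<open>m\<close>.
\<close>
definition ideal_group :: "complex set \<Rightarrow> complex set \<Rightarrow> complex set monoid"
  where "ideal_group K m =
    \<lparr>carrier = {I. fractional_ideal K I \<and>
       (\<exists>A B. ideal A (ring_of_ints K) \<and> A \<noteq> {0} \<and> comaximal K A m \<and>
              ideal B (ring_of_ints K) \<and> B \<noteq> {0} \<and> comaximal K B m \<and>
              ideal_prod CC I B = A)},
     monoid.mult = ideal_prod CC,
     one = carrier (ring_of_ints K)\<rparr>"

text \<open>
  \<open>class_field K m H L\<close>: \<open>L\<close> is the abelian extension of \<open>K\<close> unramified outside \<open>m\<close> for which
  the kernel of the Artin map on the fractional ideals prime to \<open>m\<close> is \<open>H\<close>. Archimedean primes are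
  ignored here and in \<open>ray_subgroup\<close>, so \<open>K\<close> is meant to be totally imaginary.
\<close>
definition class_field ::
    "complex set \<Rightarrow> complex set \<Rightarrow> complex set set \<Rightarrow> complex set \<Rightarrow> bool"
  where "class_field K m H L \<longleftrightarrow>
    abelian_extension K L \<and>
    (\<forall>p\<in>nonzero_primes K. \<not> unramified K L p \<longrightarrow> m \<subseteq> p) \<and>
    (\<exists>\<Phi>\<in>hom (ideal_group K m) (Gal K L).
       (\<forall>p\<in>nonzero_primes K. comaximal K p m \<longrightarrow> is_artin_symbol K L p (\<Phi> p)) \<and>
       kernel (ideal_group K m) (Gal K L) \<Phi> = H)"

definition ray_subgroup :: "complex set \<Rightarrow> complex set \<Rightarrow> complex set set"
  where "ray_subgroup K m = generate (ideal_group K m)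
    {cgenideal (ring_of_ints K) a | a. a \<in> carrier (ring_of_ints K) \<and> a \<noteq> 0 \<and> a - 1 \<in> m}"

definition ring_subgroup :: "complex set \<Rightarrow> nat \<Rightarrow> complex set set"
  where "ring_subgroup K f =
    generate (ideal_group K (cgenideal (ring_of_ints K) (of_nat f)))
      {cgenideal (ring_of_ints K) a | a. a \<in> carrier (ring_of_ints K) \<and> a \<noteq> 0 \<and>
         (\<exists>c :: int. coprime c (int f) \<and> a - of_int c \<in> cgenideal (ring_of_ints K) (of_nat f))}"

definition is_ray_class_field :: "complex set \<Rightarrow> complex set \<Rightarrow> complex set \<Rightarrow> bool"
  where "is_ray_class_field K m L \<longleftrightarrow> class_field K m (ray_subgroup K m) L"

definition is_ring_class_field :: "complex set \<Rightarrow> nat \<Rightarrow> complex set \<Rightarrow> bool"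
  where "is_ring_class_field K f L \<longleftrightarrow>
    class_field K (cgenideal (ring_of_ints K) (of_nat f)) (ring_subgroup K f) L"

end

theory Submission
  imports Defs "Jordan_Normal_Form.Char_Poly"
begin

text \<open>
  The restrictions of \<open>\<tau>\<close> to \<open>\<Sigma>\<close> and \<open>\<Omega>\<close> are the Artin symbols of \<open>p3\<close> there, so
  \<open>\<tau> ^ k = 1\<close> holds iff \<open>p3 ^ k\<close> lies in both the ray subgroup modulo \<open>p3'\<^sup>2\<close> and the ring
  subgroup modulo \<open>f\<close>. An integral ideal in the first is generated by some \<open>\<alpha> \<equiv> 1\<close> modulo
  \<open>p3'\<^sup>2\<close>, and \<open>p3 ^ k\<close> in the second by an element of the order of conductor \<open>f\<close>; the two
  generators agree up to sign because \<open>d\<^sub>K \<equiv> 1\<close> modulo 3 forces \<open>d\<^sub>K < -4\<close> and hence the units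
  to be \<open>\<plusminus>1\<close>. Finally \<open>x\<close> is the trace of \<open>\<alpha>\<close>, and for \<open>k \<ge> 2\<close> the conjugate of \<open>\<alpha>\<close> lies in
  \<open>p3'\<^sup>2\<close>, so \<open>x \<equiv> \<alpha> \<equiv> \<plusminus>1\<close> modulo \<open>p3'\<^sup>2\<close>, that is, modulo 9.
\<close>

hide_const (open) UnivPoly.coeff Divisibility.prime

subsection \<open>Algebraic integers form a ring\<close>

lemma algebraic_int_eigenvalue:
  fixes x :: "'a :: field_char_0"
  assumes A: "A \<in> carrier_mat n n" and x: "eigenvalue (map_mat of_int A) x"
  shows "algebraic_int x"
proof
  let ?M = "map_mat of_int A :: 'a mat"
  have M: "?M \<in> carrier_mat n n"
    using A by simp
  have char_poly_eq: "char_poly ?M = map_poly of_int (char_poly A)"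
    using of_int_hom.char_poly_hom[OF A] by simp
  show "lead_coeff (char_poly ?M) = 1"
    using degree_monic_char_poly[OF M] by simp
  show "\<forall>i. coeff (char_poly ?M) i \<in> \<int>"
    unfolding char_poly_eq by (simp add: coeff_map_poly)
  show "poly (char_poly ?M) x = 0"
    using eigenvalue_root_char_poly[OF M] x by simp
qed

lemma algebraic_int_if_int_matrix:
  fixes x :: "'a :: field_char_0" and n :: nat
  assumes mult_x: "\<And>i. i < n \<Longrightarrow> x * h i = (\<Sum>j<n. of_int (c i j) * h j)"
    and "i < n" and "h i \<noteq> 0"
  shows "algebraic_int x"
proof (rule algebraic_int_eigenvalue)
  define A where "A = mat n n (\<lambda>(i, j). c i j)"
  let ?M = "map_mat of_int A :: 'a mat" and ?v = "vec n h"
  show "A \<in> carrier_mat n n"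
    by (simp add: A_def)
  have "?M *\<^sub>v ?v = x \<cdot>\<^sub>v ?v"
    by (rule eq_vecI)
      (simp_all add: A_def scalar_prod_def mult_x atLeast0LessThan)
  moreover have "?v \<noteq> 0\<^sub>v n"
    using \<open>i < n\<close> \<open>h i \<noteq> 0\<close> by (metis index_vec index_zero_vec(1))
  moreover have "dim_row ?M = n"
    by (simp add: A_def)
  ultimately have "eigenvector ?M ?v x"
    by (simp add: eigenvector_def)
  thus "eigenvalue ?M x"
    unfolding eigenvalue_def by (rule exI)
qed

context
begin

interpretation int_module: Modules.module "\<lambda>(k :: int) (x :: 'a :: comm_ring_1). of_int k * x"
  by unfold_locales (simp_all add: algebra_simps)

declare int_module.scale_scale [simp del]

abbreviation int_span :: "'a :: comm_ring_1 set \<Rightarrow> 'a set"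
  where "int_span \<equiv> int_module.span"

lemma int_span_mult_right:
  assumes "\<And>b. b \<in> B \<Longrightarrow> x * b \<in> int_span C" and "y \<in> int_span B"
  shows "x * y \<in> int_span C"
  using assms(2)
proof (induction rule: int_module.span_induct_alt)
  case base
  show ?case by (simp add: int_module.span_zero)
next
  case (step k b y)
  have "of_int k * (x * b) + x * y \<in> int_span C"
    using assms(1) step by (intro int_module.span_add int_module.span_scale)
  thus ?case by (simp add: algebra_simps)
qed

lemma algebraic_int_if_int_span_stable:
  fixes x :: "'a :: field_char_0"
  assumes "finite B" and "1 \<in> B" and stable: "\<And>b. b \<in> B \<Longrightarrow> x * b \<in> int_span B"
  shows "algebraic_int x"
proof -
  have "\<exists>u :: 'a \<Rightarrow> int. x * b = (\<Sum>e\<in>B. of_int (u e) * e)" if "b \<in> B" for b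
    using stable[OF that] by (auto simp: int_module.span_finite[OF \<open>finite B\<close>])
  then obtain c :: "'a \<Rightarrow> 'a \<Rightarrow> int"
    where mult_x: "\<And>b. b \<in> B \<Longrightarrow> x * b = (\<Sum>e\<in>B. of_int (c b e) * e)"
    by metis
  obtain h where h: "bij_betw h {..<card B} B"
    using ex_bij_betw_nat_finite[OF \<open>finite B\<close>] by (auto simp: atLeast0LessThan)
  then obtain i where "i < card B" "h i = 1"
    using \<open>1 \<in> B\<close> by (metis bij_betw_imp_surj_on imageE lessThan_iff)
  moreover have "x * h i = (\<Sum>j<card B. of_int (c (h i) (h j)) * h j)" if "i < card B" for i
    using mult_x[of "h i"] that bij_betw_apply[OF h]
      sum.reindex_bij_betw[OF h, of "\<lambda>e. of_int (c (h i) e) * e"] by simp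
  ultimately show ?thesis
    by (intro algebraic_int_if_int_matrix[of "card B" x h "\<lambda>i j. c (h i) (h j)" i]) simp_all
qed

lemma algebraic_int_imp_int_span_stable:
  fixes x :: "'a :: field_char_0"
  assumes "algebraic_int x"
  obtains B where "finite B" "1 \<in> B" "\<And>b. b \<in> B \<Longrightarrow> x * b \<in> int_span B"
proof -
  obtain p :: "int poly" where root: "poly (map_poly of_int p) x = 0" and monic: "lead_coeff p = 1"
    using assms unfolding algebraic_int_altdef_ipoly by blast
  define m where "m = Polynomial.degree p"
  define B where "B = (\<lambda>i. x ^ i) ` {..<m}"
  have "poly (map_poly of_int p) x = (\<Sum>i<m. of_int (coeff p i) * x ^ i) + x ^ m"
    using monic by (simp add: poly_altdef m_def coeff_map_poly flip: lessThan_Suc_atMost)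
  hence top: "x ^ m = - (\<Sum>i<m. of_int (coeff p i) * x ^ i)"
    using root by (simp add: eq_neg_iff_add_eq_0 add.commute)
  have "x ^ m \<in> int_span B"
    unfolding top B_def
    by (intro int_module.span_neg int_module.span_sum int_module.span_scale int_module.span_base)
      auto
  hence "x ^ i \<in> int_span B" if "i \<le> m" for i
    using that by (cases "i = m") (auto simp: B_def intro: int_module.span_base)
  hence "x * b \<in> int_span B" if "b \<in> B" for b
    using that by (auto simp: B_def Suc_le_eq simp flip: power_Suc)
  moreover have "m \<noteq> 0"
  proof
    assume "m = 0"
    with top show False by simp
  qed
  hence "1 \<in> B"
    by (auto simp: B_def intro!: image_eqI[of _ _ 0])
  moreover have "finite B"
    by (simp add: B_def)
  ultimately show ?thesis
    using that by blast
qed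

lemma algebraic_int_pair_imp_int_span_stable:
  fixes x y :: "'a :: field_char_0"
  assumes "algebraic_int x" and "algebraic_int y"
  obtains B where "finite B" "1 \<in> B"
    "\<And>b. b \<in> B \<Longrightarrow> x * b \<in> int_span B" "\<And>b. b \<in> B \<Longrightarrow> y * b \<in> int_span B"
proof -
  obtain C where C: "finite C" "1 \<in> C" "\<And>c. c \<in> C \<Longrightarrow> x * c \<in> int_span C"
    using algebraic_int_imp_int_span_stable[OF assms(1)] by blast
  obtain E where E: "finite E" "1 \<in> E" "\<And>e. e \<in> E \<Longrightarrow> y * e \<in> int_span E"
    using algebraic_int_imp_int_span_stable[OF assms(2)] by blast
  define B where "B = (\<lambda>(c, e). c * e) ` (C \<times> E)"
  have mult_in_B: "c * e \<in> int_span B" if "c \<in> C" "e \<in> E" for c e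
    using that by (intro int_module.span_base) (auto simp: B_def)
  have "x * b \<in> int_span B" if "b \<in> B" for b
  proof -
    from that obtain c e where "b = c * e" "c \<in> C" "e \<in> E"
      by (auto simp: B_def)
    thus ?thesis
      using int_span_mult_right[OF _ C(3), of e B c] mult_in_B
      by (simp add: mult.commute mult.left_commute)
  qed
  moreover have "y * b \<in> int_span B" if "b \<in> B" for b
  proof -
    from that obtain c e where "b = c * e" "c \<in> C" "e \<in> E"
      by (auto simp: B_def)
    thus ?thesis
      using int_span_mult_right[OF _ E(3), of c B e] mult_in_B by (simp add: mult.left_commute)
  qed
  moreover have "finite B" "1 \<in> B"
    using C(1,2) E(1,2) by (force simp: B_def)+
  ultimately show ?thesis
    using that by blast
qed

lemma algebraic_int_add:
  fixes x y :: "'a :: field_char_0"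
  assumes "algebraic_int x" and "algebraic_int y"
  shows "algebraic_int (x + y)"
proof -
  obtain B where B: "finite B" "1 \<in> B"
    "\<And>b. b \<in> B \<Longrightarrow> x * b \<in> int_span B" "\<And>b. b \<in> B \<Longrightarrow> y * b \<in> int_span B"
    using algebraic_int_pair_imp_int_span_stable[OF assms] by blast
  show ?thesis
    using B(3,4) by (intro algebraic_int_if_int_span_stable[OF B(1,2)])
      (simp add: distrib_right int_module.span_add)
qed

lemma algebraic_int_mult:
  fixes x y :: "'a :: field_char_0"
  assumes "algebraic_int x" and "algebraic_int y"
  shows "algebraic_int (x * y)"
proof -
  obtain B where B: "finite B" "1 \<in> B"
    "\<And>b. b \<in> B \<Longrightarrow> x * b \<in> int_span B" "\<And>b. b \<in> B \<Longrightarrow> y * b \<in> int_span B"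
    using algebraic_int_pair_imp_int_span_stable[OF assms] by blast
  show ?thesis
    using int_span_mult_right[OF B(3) B(4)]
    by (intro algebraic_int_if_int_span_stable[OF B(1,2)]) (simp add: mult.assoc)
qed

end


subsection \<open>Subfields of the complex numbers and their rings of integers\<close>

interpretation CC: cring CC
  by (rule cring_from_type_algebra)

lemma CC_simps [simp]:
  "carrier CC = UNIV" "\<zero>\<^bsub>CC\<^esub> = 0" "\<one>\<^bsub>CC\<^esub> = 1"
  "x \<oplus>\<^bsub>CC\<^esub> y = x + y" "x \<otimes>\<^bsub>CC\<^esub> y = x * y"
  by (simp_all add: ring_of_type_algebra_def)

lemma CC_a_inv [simp]: "\<ominus>\<^bsub>CC\<^esub> x = - x"
  using CC.minus_equality[of "- x" x] by simp

lemma CC_m_inv [simp]: "x \<noteq> 0 \<Longrightarrow> inv\<^bsub>CC\<^esub> x = inverse x"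
  using CC.comm_inv_char[of x "inverse x"] by simp

lemma CC_nat_pow [simp]: "x [^]\<^bsub>CC\<^esub> (n :: nat) = x ^ n"
  by (induction n) (simp_all add: mult.commute)

abbreviation ints_of :: "complex set \<Rightarrow> complex set"  (\<open>\<O>\<^bsub>_\<^esub>\<close>)
  where "\<O>\<^bsub>K\<^esub> \<equiv> carrier (ring_of_ints K)"

abbreviation principal_ideal :: "complex set \<Rightarrow> complex \<Rightarrow> complex set"
  where "principal_ideal K \<equiv> cgenideal (ring_of_ints K)"

abbreviation ideal_power :: "complex set \<Rightarrow> complex set \<Rightarrow> nat \<Rightarrow> complex set"
  where "ideal_power K I k \<equiv> I [^]\<^bsub>ideals_set (ring_of_ints K)\<^esub> k"

lemma ring_of_ints_simps [simp]:
  "\<zero>\<^bsub>ring_of_ints K\<^esub> = 0" "\<one>\<^bsub>ring_of_ints K\<^esub> = 1"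
  "x \<oplus>\<^bsub>ring_of_ints K\<^esub> y = x + y" "x \<otimes>\<^bsub>ring_of_ints K\<^esub> y = x * y"
  by (simp_all add: ring_of_ints_def)

lemma mem_ints_iff: "x \<in> \<O>\<^bsub>K\<^esub> \<longleftrightarrow> x \<in> K \<and> algebraic_int x"
  by (simp add: ring_of_ints_def)

lemma ints_subset_field: "\<O>\<^bsub>K\<^esub> \<subseteq> K"
  by (auto simp: mem_ints_iff)

lemma ints_of_mono: "K \<subseteq> L \<Longrightarrow> \<O>\<^bsub>K\<^esub> \<subseteq> \<O>\<^bsub>L\<^esub>"
  by (auto simp: mem_ints_iff)

lemma of_int_dvd_if_algebraic_int:
  assumes "of_int x = of_int a * (w :: complex)" and "algebraic_int w"
  shows "a dvd x"
proof (cases "a = 0")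
  case False
  hence "w = of_int x / of_int a" using assms(1) by simp
  hence "w \<in> \<rat>" by simp
  hence "w \<in> \<int>" using rational_algebraic_int_is_int assms(2) by blast
  then obtain z where "w = of_int z" by (auto elim: Ints_cases)
  hence "x = a * z" using assms(1) by (metis of_int_eq_iff of_int_mult)
  thus ?thesis by simp
qed (use assms in simp)

locale complex_subfield =
  fixes K :: "complex set"
  assumes subfield: "subfield K CC"
begin

lemma zero_mem [simp]: "0 \<in> K"
  and one_mem [simp]: "1 \<in> K"
  and add_mem [simp]: "x \<in> K \<Longrightarrow> y \<in> K \<Longrightarrow> x + y \<in> K"
  and uminus_mem [simp]: "x \<in> K \<Longrightarrow> - x \<in> K"
  and mult_mem [simp]: "x \<in> K \<Longrightarrow> y \<in> K \<Longrightarrow> x * y \<in> K"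
  using subringE[OF subfieldE(1)[OF subfield]] by simp_all

lemma diff_mem [simp]: "x \<in> K \<Longrightarrow> y \<in> K \<Longrightarrow> x - y \<in> K"
  using add_mem[of x "- y"] by simp

lemma inverse_mem [simp]: "x \<in> K \<Longrightarrow> inverse x \<in> K"
  using CC.subfield_m_inv(1)[OF subfield, of x] by (cases "x = 0") simp_all

lemma divide_mem [simp]: "x \<in> K \<Longrightarrow> y \<in> K \<Longrightarrow> x / y \<in> K"
  by (simp add: divide_inverse)

lemma power_mem [simp]: "x \<in> K \<Longrightarrow> x ^ n \<in> K"
  by (induction n) simp_all

lemma sum_mem: "(\<And>i. i \<in> I \<Longrightarrow> g i \<in> K) \<Longrightarrow> sum g I \<in> K"
  by (induction I rule: infinite_finite_induct) simp_all

lemma of_nat_mem [simp]: "of_nat n \<in> K"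
  by (induction n) simp_all

lemma of_int_mem [simp]: "of_int k \<in> K"
  by (cases k rule: int_cases2) simp_all

lemma numeral_mem [simp]: "numeral n \<in> K"
  using of_nat_mem[of "numeral n"] by simp

lemma Rats_mem: "r \<in> \<rat> \<Longrightarrow> r \<in> K"
  by (elim Rats_cases') simp

lemma ints_zero [simp]: "0 \<in> \<O>\<^bsub>K\<^esub>"
  and ints_one [simp]: "1 \<in> \<O>\<^bsub>K\<^esub>"
  and ints_of_int [simp]: "of_int k \<in> \<O>\<^bsub>K\<^esub>"
  and ints_of_nat [simp]: "of_nat n \<in> \<O>\<^bsub>K\<^esub>"
  and ints_numeral [simp]: "numeral m \<in> \<O>\<^bsub>K\<^esub>"
  and ints_uminus [simp]: "x \<in> \<O>\<^bsub>K\<^esub> \<Longrightarrow> - x \<in> \<O>\<^bsub>K\<^esub>"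
  and ints_add [simp]: "x \<in> \<O>\<^bsub>K\<^esub> \<Longrightarrow> y \<in> \<O>\<^bsub>K\<^esub> \<Longrightarrow> x + y \<in> \<O>\<^bsub>K\<^esub>"
  and ints_mult [simp]: "x \<in> \<O>\<^bsub>K\<^esub> \<Longrightarrow> y \<in> \<O>\<^bsub>K\<^esub> \<Longrightarrow> x * y \<in> \<O>\<^bsub>K\<^esub>"
  by (simp_all add: mem_ints_iff algebraic_int_add algebraic_int_mult int_imp_algebraic_int)

lemma ints_diff [simp]: "x \<in> \<O>\<^bsub>K\<^esub> \<Longrightarrow> y \<in> \<O>\<^bsub>K\<^esub> \<Longrightarrow> x - y \<in> \<O>\<^bsub>K\<^esub>"
  using ints_add[of x "- y"] by simp

sublocale ints: cring "ring_of_ints K"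
proof -
  have "subring \<O>\<^bsub>K\<^esub> CC"
    by (rule CC.subringI) auto
  hence "cring (CC\<lparr>carrier := \<O>\<^bsub>K\<^esub>\<rparr>)"
    using CC.subcring_iff CC.subcringI' by simp
  thus "cring (ring_of_ints K)"
    by (simp add: ring_of_ints_def)
qed

end

lemma complex_subfield_generate_field: "complex_subfield (generate_field CC S)"
  using field.generate_field_is_subfield[OF field_from_type_algebra, of S]
  by (simp add: complex_subfield_def)


subsection \<open>Ideals of rings of integers\<close>

lemma ideal_prod_ring_of_ints: "ideal_prod (ring_of_ints K) = ideal_prod CC"
proof (intro ext equalityI subsetI)
  show "x \<in> ideal_prod CC I J" if "x \<in> ideal_prod (ring_of_ints K) I J" for I J x
    using that by induction (metis CC_simps ring_of_ints_simps ideal_prod.intros)+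
  show "x \<in> ideal_prod (ring_of_ints K) I J" if "x \<in> ideal_prod CC I J" for I J x
    using that by induction (metis CC_simps ring_of_ints_simps ideal_prod.intros)+
qed

lemma ideals_set_ring_of_ints_simps [simp]:
  "carrier (ideals_set (ring_of_ints K)) = {I. ideal I (ring_of_ints K)}"
  "\<one>\<^bsub>ideals_set (ring_of_ints K)\<^esub> = \<O>\<^bsub>K\<^esub>"
  "I \<otimes>\<^bsub>ideals_set (ring_of_ints K)\<^esub> J = ideal_prod CC I J"
  by (simp_all add: ideals_set_def ideal_prod_ring_of_ints)

lemma ideal_prod_CC_mult: "i \<in> I \<Longrightarrow> j \<in> J \<Longrightarrow> i * j \<in> ideal_prod CC I J"
  using ideal_prod.prod[of i I j J CC] by simp

lemma ideal_prod_CC_add: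
  "x \<in> ideal_prod CC I J \<Longrightarrow> y \<in> ideal_prod CC I J \<Longrightarrow> x + y \<in> ideal_prod CC I J"
  using ideal_prod.sum[of x CC I J y] by simp

lemma ideal_prod_CC_subset:
  assumes "\<And>i j. i \<in> I \<Longrightarrow> j \<in> J \<Longrightarrow> i * j \<in> M" and "\<And>x y. x \<in> M \<Longrightarrow> y \<in> M \<Longrightarrow> x + y \<in> M"
  shows "ideal_prod CC I J \<subseteq> M"
proof
  show "x \<in> M" if "x \<in> ideal_prod CC I J" for x
    using that by induction (use assms in auto)
qed

lemma ideal_prod_CC_commute: "ideal_prod CC I J = ideal_prod CC J I"
proof -
  have "ideal_prod CC I J \<subseteq> ideal_prod CC J I" for I J
    by (rule ideal_prod_CC_subset)
      (metis ideal_prod_CC_mult mult.commute, rule ideal_prod_CC_add)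
  thus ?thesis by blast
qed

lemma ideal_prod_CC_assoc:
  "ideal_prod CC (ideal_prod CC I J) M = ideal_prod CC I (ideal_prod CC J M)"
proof -
  have *: "ideal_prod CC (ideal_prod CC I J) M \<subseteq> ideal_prod CC I (ideal_prod CC J M)" for I J M
  proof (rule ideal_prod_CC_subset)
    fix x m assume "x \<in> ideal_prod CC I J" "m \<in> M"
    thus "x * m \<in> ideal_prod CC I (ideal_prod CC J M)"
      by induction
        (simp_all add: distrib_right mult.assoc ideal_prod_CC_mult ideal_prod_CC_add)
  qed (rule ideal_prod_CC_add)
  show ?thesis
    using *[of I J M] *[of M J I] by (simp add: ideal_prod_CC_commute)
qed

lemma mem_principal_ideal_iff: "x \<in> principal_ideal K a \<longleftrightarrow> (\<exists>r\<in>\<O>\<^bsub>K\<^esub>. x = r * a)"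
  by (auto simp: cgenideal_def)

lemma mult_mem_principal_ideal: "r \<in> \<O>\<^bsub>K\<^esub> \<Longrightarrow> r * a \<in> principal_ideal K a"
  by (auto simp: mem_principal_ideal_iff)

lemma principal_ideal_one [simp]: "principal_ideal K 1 = \<O>\<^bsub>K\<^esub>"
  by (auto simp: mem_principal_ideal_iff)

lemma comaximal_commute:
  assumes "ideal I (ring_of_ints K)" and "ideal J (ring_of_ints K)"
  shows "comaximal K I J \<longleftrightarrow> comaximal K J I"
  unfolding comaximal_def
  by (metis assms additive_subgroup.a_subset ideal.axioms(1,2) ring.set_add_comm)

context complex_subfield
begin

lemma ideal_ring_of_intsI:
  assumes "I \<subseteq> \<O>\<^bsub>K\<^esub>" and "0 \<in> I" and "\<And>x y. x \<in> I \<Longrightarrow> y \<in> I \<Longrightarrow> x + y \<in> I"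
    and mult: "\<And>r x. r \<in> \<O>\<^bsub>K\<^esub> \<Longrightarrow> x \<in> I \<Longrightarrow> r * x \<in> I"
  shows "ideal I (ring_of_ints K)"
proof (rule idealI[OF ints.ring_axioms])
  have "\<ominus>\<^bsub>ring_of_ints K\<^esub> x \<in> I" if "x \<in> I" for x
    using mult[of "-1" x] that assms(1) ints.minus_equality[of "- x" x] by auto
  thus "subgroup I (add_monoid (ring_of_ints K))"
    using assms unfolding subgroup_def a_inv_def by auto
  show "x \<otimes>\<^bsub>ring_of_ints K\<^esub> a \<in> I" "a \<otimes>\<^bsub>ring_of_ints K\<^esub> x \<in> I" if "a \<in> I" "x \<in> \<O>\<^bsub>K\<^esub>" for a x
    using mult[OF that(2,1)] by (simp_all add: mult.commute)
qed

lemma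
  assumes "ideal I (ring_of_ints K)"
  shows ideal_subset_ints: "I \<subseteq> \<O>\<^bsub>K\<^esub>"
    and ideal_zero: "0 \<in> I"
    and ideal_add: "x \<in> I \<Longrightarrow> y \<in> I \<Longrightarrow> x + y \<in> I"
    and ideal_mult_left: "r \<in> \<O>\<^bsub>K\<^esub> \<Longrightarrow> x \<in> I \<Longrightarrow> r * x \<in> I"
    and ideal_mult_right: "r \<in> \<O>\<^bsub>K\<^esub> \<Longrightarrow> x \<in> I \<Longrightarrow> x * r \<in> I"
proof -
  interpret ideal I "ring_of_ints K" by fact
  show "I \<subseteq> \<O>\<^bsub>K\<^esub>" by (rule a_subset)
  show "0 \<in> I" using zero_closed by simp
  show "x \<in> I \<Longrightarrow> y \<in> I \<Longrightarrow> x + y \<in> I" using a_closed by simp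
  show "r \<in> \<O>\<^bsub>K\<^esub> \<Longrightarrow> x \<in> I \<Longrightarrow> r * x \<in> I" using I_l_closed by simp
  show "r \<in> \<O>\<^bsub>K\<^esub> \<Longrightarrow> x \<in> I \<Longrightarrow> x * r \<in> I" using I_r_closed by simp
qed

lemma ideal_uminus: "ideal I (ring_of_ints K) \<Longrightarrow> x \<in> I \<Longrightarrow> - x \<in> I"
  using ideal_mult_left[of I "-1" x] by simp

lemma ideal_diff: "ideal I (ring_of_ints K) \<Longrightarrow> x \<in> I \<Longrightarrow> y \<in> I \<Longrightarrow> x - y \<in> I"
  using ideal_add[of I x "- y"] ideal_uminus by simp

lemma
  assumes "primeideal P (ring_of_ints K)"
  shows primeideal_is_ideal: "ideal P (ring_of_ints K)"
    and one_notin_primeideal: "1 \<notin> P"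
    and primeideal_mult: "a \<in> \<O>\<^bsub>K\<^esub> \<Longrightarrow> b \<in> \<O>\<^bsub>K\<^esub> \<Longrightarrow> a * b \<in> P \<Longrightarrow> a \<in> P \<or> b \<in> P"
proof -
  interpret primeideal P "ring_of_ints K" by fact
  show "ideal P (ring_of_ints K)" by (rule is_ideal)
  show "1 \<notin> P" using I_notcarr one_imp_carrier by auto
  show "a \<in> \<O>\<^bsub>K\<^esub> \<Longrightarrow> b \<in> \<O>\<^bsub>K\<^esub> \<Longrightarrow> a * b \<in> P \<Longrightarrow> a \<in> P \<or> b \<in> P"
    using I_prime[of a b] by simp
qed

lemma ideal_ints: "ideal \<O>\<^bsub>K\<^esub> (ring_of_ints K)"
  by (rule ints.oneideal)

lemma ints_ne_zero: "\<O>\<^bsub>K\<^esub> \<noteq> {0}"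
  using ints_one by (metis singletonD zero_neq_one)

sublocale ideals: comm_monoid "ideals_set (ring_of_ints K)"
  by (rule ints.ideals_set_is_comm_monoid)

lemma ideal_prod_is_ideal:
  "ideal I (ring_of_ints K) \<Longrightarrow> ideal J (ring_of_ints K) \<Longrightarrow> ideal (ideal_prod CC I J) (ring_of_ints K)"
  using ideals.m_closed[of I J] by simp

lemma ideal_ints_prod: "ideal I (ring_of_ints K) \<Longrightarrow> ideal_prod CC I \<O>\<^bsub>K\<^esub> = I"
  using ints.ideal_prod_one by (simp add: ideal_prod_ring_of_ints)

lemma ideal_power_is_ideal: "ideal I (ring_of_ints K) \<Longrightarrow> ideal (ideal_power K I k) (ring_of_ints K)"
  using ideals.nat_pow_closed[of I k] by simp

lemma ideal_power_antimono:
  assumes I: "ideal I (ring_of_ints K)" and "j \<le> k"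
  shows "ideal_power K I k \<subseteq> ideal_power K I j"
  using \<open>j \<le> k\<close>
proof (induction k rule: dec_induct)
  case (step k)
  have "ideal_power K I (Suc k) \<subseteq> ideal_power K I k"
    using ints.ideal_prod_inter[OF ideal_power_is_ideal[OF I] I]
    by (simp add: ideal_prod_ring_of_ints)
  thus ?case using step.IH by blast
qed simp

lemma power_mem_ideal_power: "x \<in> I \<Longrightarrow> x ^ k \<in> ideal_power K I k"
  by (induction k) (simp_all add: mult.commute[of x] ideal_prod_CC_mult)

lemma ideal_power_ne_zero:
  assumes "ideal I (ring_of_ints K)" and "I \<noteq> {0}"
  shows "ideal_power K I k \<noteq> {0}"
proof -
  obtain x where "x \<in> I" "x \<noteq> 0"
    using assms ideal_zero by blast
  thus ?thesis
    using power_mem_ideal_power power_not_zero by blast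
qed

lemma self_mem_principal_ideal [simp]: "a \<in> principal_ideal K a"
  using mult_mem_principal_ideal[OF ints_one] by simp

lemma image_mult_principal_ideal: "(\<lambda>x. c * x) ` principal_ideal K a = principal_ideal K (c * a)"
proof -
  have "principal_ideal K b = (\<lambda>r. r * b) ` \<O>\<^bsub>K\<^esub>" for b
    by (auto simp: cgenideal_def)
  thus ?thesis
    by (simp add: image_image mult.left_commute)
qed

lemma principal_ideal_zero: "principal_ideal K 0 = {0}"
  by (auto simp: mem_principal_ideal_iff intro!: exI[of _ 0])

lemma principal_ideal_ne_zero: "a \<noteq> 0 \<Longrightarrow> principal_ideal K a \<noteq> {0}"
  using self_mem_principal_ideal by blast

lemma mem_ints_if_principal_ideal_subset: "principal_ideal K a \<subseteq> \<O>\<^bsub>K\<^esub> \<Longrightarrow> a \<in> \<O>\<^bsub>K\<^esub>"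
  using self_mem_principal_ideal by blast

lemma principal_ideal_add:
  assumes "x \<in> principal_ideal K a" and "y \<in> principal_ideal K a"
  shows "x + y \<in> principal_ideal K a"
proof -
  obtain r t where "r \<in> \<O>\<^bsub>K\<^esub>" "t \<in> \<O>\<^bsub>K\<^esub>" "x = r * a" "y = t * a"
    using assms unfolding mem_principal_ideal_iff by blast
  thus ?thesis
    using mult_mem_principal_ideal[of "r + t" K a] by (simp add: distrib_right)
qed

lemma ideal_principal_ideal: "a \<in> \<O>\<^bsub>K\<^esub> \<Longrightarrow> ideal (principal_ideal K a) (ring_of_ints K)"
  by (rule ints.cgenideal_ideal)

lemma ideal_prod_principal_ideal:
  "ideal_prod CC (principal_ideal K a) (principal_ideal K b) = principal_ideal K (a * b)"
proof
  show "ideal_prod CC (principal_ideal K a) (principal_ideal K b) \<subseteq> principal_ideal K (a * b)"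
  proof (rule ideal_prod_CC_subset)
    fix i j assume "i \<in> principal_ideal K a" "j \<in> principal_ideal K b"
    then obtain r t where "r \<in> \<O>\<^bsub>K\<^esub>" "t \<in> \<O>\<^bsub>K\<^esub>" "i * j = (r * t) * (a * b)"
      unfolding mem_principal_ideal_iff by (metis mult.assoc mult.left_commute)
    thus "i * j \<in> principal_ideal K (a * b)"
      by (simp add: mult_mem_principal_ideal)
  qed (rule principal_ideal_add)
  show "principal_ideal K (a * b) \<subseteq> ideal_prod CC (principal_ideal K a) (principal_ideal K b)"
    using ideal_prod_CC_mult[OF mult_mem_principal_ideal self_mem_principal_ideal]
    by (auto simp: mem_principal_ideal_iff mult.assoc)
qed

lemma principal_ideal_power: "ideal_power K (principal_ideal K a) k = principal_ideal K (a ^ k)"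
  by (induction k) (simp_all add: ideal_prod_principal_ideal mult.commute)

lemma principal_ideal_uminus: "principal_ideal K (- a) = principal_ideal K a"
proof -
  have "principal_ideal K (- a) \<subseteq> principal_ideal K a" for a
    using mult_mem_principal_ideal[OF ints_uminus] by (auto simp: mem_principal_ideal_iff)
  from this[of a] this[of "- a"] show ?thesis by simp
qed

lemma comaximal_iff:
  assumes "ideal I (ring_of_ints K)" and "ideal J (ring_of_ints K)"
  shows "comaximal K I J \<longleftrightarrow> (\<exists>i\<in>I. \<exists>j\<in>J. i + j = 1)"
proof -
  have "comaximal K I J \<longleftrightarrow> 1 \<in> I <+>\<^bsub>ring_of_ints K\<^esub> J"
    using ideal.one_imp_carrier[OF ints.add_ideals[OF assms]] ints_one
    unfolding comaximal_def ring_of_ints_simps by metis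
  also have "\<dots> \<longleftrightarrow> (\<exists>i\<in>I. \<exists>j\<in>J. i + j = 1)"
    unfolding set_add_def' by (simp add: eq_commute[of 1])
  finally show ?thesis .
qed

lemma comaximalI:
  assumes "ideal I (ring_of_ints K)" and "ideal J (ring_of_ints K)"
    and "i \<in> I" and "j \<in> J" and "i + j = 1"
  shows "comaximal K I J"
  using assms comaximal_iff by blast

lemma comaximal_ints: "ideal M (ring_of_ints K) \<Longrightarrow> comaximal K \<O>\<^bsub>K\<^esub> M"
  using comaximalI[of "\<O>\<^bsub>K\<^esub>" M 1 0] ideal_ints ideal_zero by simp

lemma comaximal_if_coprime_ints:
  assumes "ideal I (ring_of_ints K)" and "ideal J (ring_of_ints K)"
    and "of_int a \<in> I" and "of_int b \<in> J" and "coprime a b"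
  shows "comaximal K I J"
proof -
  obtain u v where "u * a + v * b = 1"
    using bezout_int[of a b] \<open>coprime a b\<close> by (auto simp: coprime_iff_gcd_eq_1)
  hence "of_int u * of_int a + of_int v * of_int b = (1 :: complex)"
    by (metis of_int_1 of_int_add of_int_mult)
  thus ?thesis
    using assms(1-4) ideal_mult_left[of I "of_int u"] ideal_mult_left[of J "of_int v"]
    by (intro comaximalI) auto
qed

lemma comaximal_ideal_prod:
  assumes ideals: "ideal I (ring_of_ints K)" "ideal J (ring_of_ints K)" "ideal M (ring_of_ints K)"
    and "comaximal K I M" and "comaximal K J M"
  shows "comaximal K (ideal_prod CC I J) M"
proof -
  obtain i m where im: "i \<in> I" "m \<in> M" "i + m = 1"
    using assms(4) comaximal_iff[OF ideals(1,3)] by blast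
  obtain j l where jl: "j \<in> J" "l \<in> M" "j + l = 1"
    using assms(5) comaximal_iff[OF ideals(2,3)] by blast
  have "m * j + l \<in> M"
    using im jl ideals ideal_subset_ints by (blast intro: ideal_add ideal_mult_right)
  moreover have "i * j + (m * j + l) = 1"
    using im(3) jl(3) by (simp add: add.assoc[symmetric] distrib_right[symmetric])
  ultimately show ?thesis
    using comaximalI ideal_prod_is_ideal ideals ideal_prod_CC_mult[OF im(1) jl(1)] by blast
qed

lemma comaximal_ideal_power:
  assumes "ideal I (ring_of_ints K)" and "ideal M (ring_of_ints K)" and "comaximal K I M"
  shows "comaximal K (ideal_power K I k) M"
  by (induction k)
    (use assms in \<open>simp_all add: comaximal_ints comaximal_ideal_prod ideal_power_is_ideal\<close>)

lemma comaximal_ideal_powers: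
  assumes I: "ideal I (ring_of_ints K)" and J: "ideal J (ring_of_ints K)" and "comaximal K I J"
  shows "comaximal K (ideal_power K I j) (ideal_power K J k)"
proof -
  have "comaximal K (ideal_power K J k) I"
    using assms comaximal_commute comaximal_ideal_power by blast
  thus ?thesis
    using comaximal_commute comaximal_ideal_power ideal_power_is_ideal I J by blast
qed

end


subsection \<open>Galois groups\<close>

context complex_subfield
begin

lemma coeff_linear_mem: "b \<in> K \<Longrightarrow> coeff [:- b, 1:] i \<in> K"
  by (simp add: coeff_pCons split: nat.split)

lemma coeff_prod_linear_mem:
  assumes "T \<subseteq> K"
  shows "coeff (\<Prod>b\<in>T. [:- b, 1:]) i \<in> K"
  using assms
proof (induction T arbitrary: i rule: infinite_finite_induct)
  case (insert b T)
  thus ?case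
    unfolding prod.insert[OF insert.hyps] coeff_mult
    by (intro sum_mem mult_mem coeff_linear_mem) auto
qed (simp_all add: one_pCons coeff_pCons split: nat.split)

end

lemma one_Gal: "\<one>\<^bsub>Gal K L\<^esub> = (\<lambda>x\<in>L. x)"
  by (simp add: Gal_def BijGroup_def)

lemma mem_Gal_iff:
  "\<sigma> \<in> carrier (Gal K L) \<longleftrightarrow> \<sigma> \<in> Bij L \<and>
     (\<forall>x\<in>L. \<forall>y\<in>L. \<sigma> (x + y) = \<sigma> x + \<sigma> y \<and> \<sigma> (x * y) = \<sigma> x * \<sigma> y) \<and>
     \<sigma> 1 = 1 \<and> (\<forall>x\<in>K. \<sigma> x = x)"
  by (auto simp: Gal_def Ring.ring_hom_def Bij_imp_funcset dest: Bij_imp_funcset)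

lemma mult_Gal:
  "\<sigma> \<in> carrier (Gal K L) \<Longrightarrow> \<rho> \<in> carrier (Gal K L) \<Longrightarrow> \<sigma> \<otimes>\<^bsub>Gal K L\<^esub> \<rho> = compose L \<sigma> \<rho>"
  by (simp add: Gal_def BijGroup_def)

lemma
  assumes "\<sigma> \<in> carrier (Gal K L)"
  shows Gal_closed: "x \<in> L \<Longrightarrow> \<sigma> x \<in> L"
    and Gal_add: "x \<in> L \<Longrightarrow> y \<in> L \<Longrightarrow> \<sigma> (x + y) = \<sigma> x + \<sigma> y"
    and Gal_mult: "x \<in> L \<Longrightarrow> y \<in> L \<Longrightarrow> \<sigma> (x * y) = \<sigma> x * \<sigma> y"
    and Gal_one: "\<sigma> 1 = 1"
    and Gal_base: "x \<in> K \<Longrightarrow> \<sigma> x = x"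
    and Gal_inj_on: "inj_on \<sigma> L"
    and Gal_extensional: "\<sigma> \<in> extensional L"
  using assms by (auto simp: mem_Gal_iff Bij_def bij_betw_def)

locale complex_extension = K: complex_subfield K + L: complex_subfield L
  for K L :: "complex set" +
  assumes base_subset: "K \<subseteq> L"
begin

lemma subgroup_Gal: "subgroup (carrier (Gal K L)) (BijGroup L)"
proof (rule group.subgroupI[OF group_BijGroup])
  show "carrier (Gal K L) \<subseteq> carrier (BijGroup L)"
    by (auto simp: mem_Gal_iff BijGroup_def)
  have "(\<lambda>x\<in>L. x) \<in> carrier (Gal K L)"
    using base_subset by (auto simp: mem_Gal_iff id_Bij)
  thus "carrier (Gal K L) \<noteq> {}" by blast
next
  fix \<sigma> assume \<sigma>: "\<sigma> \<in> carrier (Gal K L)"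
  hence bij: "\<sigma> \<in> Bij L" by (simp add: mem_Gal_iff)
  have "inv_into L \<sigma> (x + y) = inv_into L \<sigma> x + inv_into L \<sigma> y" if "x \<in> L" "y \<in> L" for x y
    using that by (intro Bij_inv_into_lemma[of L \<sigma> "(+)"]) (auto simp: Gal_add[OF \<sigma>] bij)
  moreover have "inv_into L \<sigma> (x * y) = inv_into L \<sigma> x * inv_into L \<sigma> y" if "x \<in> L" "y \<in> L" for x y
    using that by (intro Bij_inv_into_lemma[of L \<sigma> "(*)"]) (auto simp: Gal_mult[OF \<sigma>] bij)
  moreover have "inv_into L \<sigma> x = x" if "x \<in> K" for x
    using that base_subset Gal_base[OF \<sigma>]
    by (intro inv_into_f_eq[OF Gal_inj_on[OF \<sigma>]]) auto
  ultimately show "inv\<^bsub>BijGroup L\<^esub> \<sigma> \<in> carrier (Gal K L)"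
    using base_subset restrict_inv_into_Bij[OF bij]
    by (auto simp: inv_BijGroup[OF bij] mem_Gal_iff subset_iff)
next
  fix \<sigma> \<rho> assume \<sigma>\<rho>: "\<sigma> \<in> carrier (Gal K L)" "\<rho> \<in> carrier (Gal K L)"
  hence "\<sigma> \<otimes>\<^bsub>BijGroup L\<^esub> \<rho> = compose L \<sigma> \<rho>"
    by (simp add: BijGroup_def mem_Gal_iff)
  moreover have "compose L \<sigma> \<rho> \<in> Bij L"
    using \<sigma>\<rho> by (simp add: compose_Bij mem_Gal_iff)
  ultimately show "\<sigma> \<otimes>\<^bsub>BijGroup L\<^esub> \<rho> \<in> carrier (Gal K L)"
    using \<sigma>\<rho> base_subset Gal_closed[OF \<sigma>\<rho>(2)]
    by (auto simp: mem_Gal_iff compose_eq subset_iff)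
qed

sublocale Gal: group "Gal K L"
  using subgroup.subgroup_is_group[OF subgroup_Gal group_BijGroup] by (simp add: Gal_def)

lemma Gal_eq_one_iff:
  assumes "\<sigma> \<in> carrier (Gal K L)"
  shows "\<sigma> = \<one>\<^bsub>Gal K L\<^esub> \<longleftrightarrow> (\<forall>x\<in>L. \<sigma> x = x)"
  using Gal_extensional[OF assms] by (auto simp: one_Gal extensional_def fun_eq_iff)

context
  fixes \<sigma> :: "complex \<Rightarrow> complex"
  assumes \<sigma>: "\<sigma> \<in> carrier (Gal K L)"
begin

lemma Gal_zero: "\<sigma> 0 = 0"
  using Gal_base[OF \<sigma>] by simp

lemma Gal_uminus: "x \<in> L \<Longrightarrow> \<sigma> (- x) = - \<sigma> x"
  using Gal_mult[OF \<sigma>, of "-1" x] Gal_base[OF \<sigma>, of "-1"] by simp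

lemma Gal_inverse:
  assumes "x \<in> L"
  shows "\<sigma> (inverse x) = inverse (\<sigma> x)"
proof (cases "x = 0")
  case False
  have "\<sigma> x * \<sigma> (inverse x) = 1"
    using Gal_mult[OF \<sigma>, of x "inverse x"] assms False by (simp add: Gal_one[OF \<sigma>])
  thus ?thesis by (metis inverse_unique)
qed (simp add: Gal_zero)

lemma Gal_sum: "(\<And>i. i \<in> I \<Longrightarrow> g i \<in> L) \<Longrightarrow> \<sigma> (sum g I) = (\<Sum>i\<in>I. \<sigma> (g i))"
  by (induction I rule: infinite_finite_induct) (simp_all add: Gal_zero Gal_add[OF \<sigma>] L.sum_mem)

lemma Gal_map_poly_pCons: "map_poly \<sigma> (pCons c p) = pCons (\<sigma> c) (map_poly \<sigma> p)"
  using Gal_zero by (rule Polynomial.map_poly_pCons)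

lemma Gal_poly:
  assumes "x \<in> L" and "\<And>i. coeff p i \<in> L"
  shows "\<sigma> (poly p x) = poly (map_poly \<sigma> p) (\<sigma> x)"
proof -
  have "poly p x \<in> L \<and> \<sigma> (poly p x) = poly (map_poly \<sigma> p) (\<sigma> x)"
    using assms(2)
  proof (induction p)
    case (pCons c p)
    have "c \<in> L" "coeff p i \<in> L" for i
      using pCons.prems[of 0] pCons.prems[of "Suc i"] by simp_all
    thus ?case
      using pCons.IH \<open>x \<in> L\<close>
      by (simp add: Gal_map_poly_pCons Gal_add[OF \<sigma>] Gal_mult[OF \<sigma>])
  qed (simp add: Gal_zero)
  thus ?thesis ..
qed

lemma Gal_poly_base:
  assumes "x \<in> L" and coeffs: "\<And>i. coeff p i \<in> K"
  shows "\<sigma> (poly p x) = poly p (\<sigma> x)"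
proof -
  have "map_poly \<sigma> p = p"
    using coeffs by (intro poly_eqI) (simp add: coeff_map_poly Gal_zero Gal_base[OF \<sigma>])
  thus ?thesis
    using Gal_poly[OF \<open>x \<in> L\<close>, of p] coeffs base_subset by auto
qed

lemma Gal_map_poly_mult:
  assumes "\<And>i. coeff p i \<in> L" and "\<And>i. coeff q i \<in> L"
  shows "map_poly \<sigma> (p * q) = map_poly \<sigma> p * map_poly \<sigma> q"
  using assms
  by (intro poly_eqI)
    (simp add: coeff_map_poly Gal_zero coeff_mult Gal_sum Gal_mult[OF \<sigma>])

lemma Gal_map_poly_prod_linear:
  assumes "T \<subseteq> L"
  shows "map_poly \<sigma> (\<Prod>b\<in>T. [:- b, 1:]) = (\<Prod>b\<in>T. [:- \<sigma> b, 1:])"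
  using assms
proof (induction T rule: infinite_finite_induct)
  case (insert b T)
  hence "map_poly \<sigma> ([:- b, 1:] * (\<Prod>b\<in>T. [:- b, 1:])) =
    map_poly \<sigma> [:- b, 1:] * map_poly \<sigma> (\<Prod>b\<in>T. [:- b, 1:])"
    by (intro Gal_map_poly_mult L.coeff_linear_mem L.coeff_prod_linear_mem) auto
  also have "map_poly \<sigma> [:- b, 1:] = [:- \<sigma> b, 1:]"
    using insert.prems by (simp add: Gal_map_poly_pCons Gal_one[OF \<sigma>] Gal_uminus)
  finally show ?case
    using insert by (simp only: prod.insert[OF insert.hyps] insert_subset)
qed (simp_all add: one_pCons Gal_map_poly_pCons Gal_one[OF \<sigma>])

end

end


subsection \<open>Galois extensions and restriction of automorphisms\<close>

lemma CC_eval_eq_poly: "ring.eval CC p x = poly (Poly (rev p)) x"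
  by (induction p)
    (simp_all add: CC.eval.simps Poly_snoc poly_monom)

lemma algebraic_over_imp_root:
  assumes "subfield K CC" and "((ring.algebraic CC) over K) a"
  obtains p where "p \<noteq> 0" "\<And>i. coeff p i \<in> K" "poly p a = 0"
proof -
  interpret field CC by (rule field_from_type_algebra)
  obtain q where q: "q \<in> carrier (K[X]\<^bsub>CC\<^esub>)" "q \<noteq> []" "CC.eval q a = 0"
    using algebraicE[OF subfieldE(1)[OF assms(1)] _ assms(2)] by auto
  hence "hd q \<noteq> 0" "set q \<subseteq> K"
    by (auto simp: univ_poly_def polynomial_def)
  show ?thesis
  proof (rule that)
    show "Poly (rev q) \<noteq> 0"
      using \<open>hd q \<noteq> 0\<close> \<open>q \<noteq> []\<close> by (metis Poly_eq_0 hd_in_set in_set_replicate set_rev)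
    show "coeff (Poly (rev q)) i \<in> K" for i
      using \<open>set q \<subseteq> K\<close> subringE(2)[OF subfieldE(1)[OF assms(1)]]
      by (auto simp: nth_default_def rev_nth)
    show "poly (Poly (rev q)) a = 0"
      using q(3) by (simp add: CC_eval_eq_poly)
  qed
qed

locale complex_galois_extension =
  fixes K M :: "complex set"
  assumes galois: "galois_extension K M"

sublocale complex_galois_extension \<subseteq> complex_extension K M
  using galois
  by (simp add: galois_extension_def complex_extension_def complex_extension_axioms_def
      complex_subfield_def)

context complex_galois_extension
begin

lemma mem_base_if_Gal_fixed: "x \<in> M \<Longrightarrow> (\<And>\<rho>. \<rho> \<in> carrier (Gal K M) \<Longrightarrow> \<rho> x = x) \<Longrightarrow> x \<in> K"
  using galois unfolding galois_extension_def by blast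

definition Gal_orbit :: "complex \<Rightarrow> complex set"
  where "Gal_orbit a = (\<lambda>\<rho>. \<rho> a) ` carrier (Gal K M)"

lemma self_mem_Gal_orbit: "a \<in> M \<Longrightarrow> a \<in> Gal_orbit a"
  unfolding Gal_orbit_def
  by (rule image_eqI[OF _ Gal.one_closed]) (simp add: one_Gal)

lemma Gal_orbit_subset: "a \<in> M \<Longrightarrow> Gal_orbit a \<subseteq> M"
  by (auto simp: Gal_orbit_def Gal_closed)

lemma finite_Gal_orbit:
  assumes "a \<in> M"
  shows "finite (Gal_orbit a)"
proof -
  have "((ring.algebraic CC) over K) a"
    using galois \<open>a \<in> M\<close> subfieldE(1) unfolding galois_extension_def
    by (metis CC.finite_dimension_imp_algebraic)
  then obtain p where p: "p \<noteq> 0" "\<And>i. coeff p i \<in> K" "poly p a = 0"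
    using algebraic_over_imp_root K.subfield by blast
  have "poly p (\<rho> a) = 0" if "\<rho> \<in> carrier (Gal K M)" for \<rho>
    using Gal_poly_base[OF that \<open>a \<in> M\<close> p(2)] p(3) Gal_zero[OF that] by simp
  hence "Gal_orbit a \<subseteq> {x. poly p x = 0}"
    by (auto simp: Gal_orbit_def)
  thus ?thesis
    using poly_roots_finite[OF p(1)] finite_subset by blast
qed

lemma Gal_image_orbit:
  assumes \<rho>: "\<rho> \<in> carrier (Gal K M)" and "a \<in> M"
  shows "\<rho> ` Gal_orbit a = Gal_orbit a"
proof (rule endo_inj_surj[OF finite_Gal_orbit[OF \<open>a \<in> M\<close>]])
  show "inj_on \<rho> (Gal_orbit a)"
    using Gal_inj_on[OF \<rho>] Gal_orbit_subset[OF \<open>a \<in> M\<close>] by (rule inj_on_subset)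
  have "\<rho> (\<nu> a) \<in> Gal_orbit a" if "\<nu> \<in> carrier (Gal K M)" for \<nu>
  proof -
    have "\<rho> (\<nu> a) = (\<rho> \<otimes>\<^bsub>Gal K M\<^esub> \<nu>) a"
      using mult_Gal[OF \<rho> that] \<open>a \<in> M\<close> by (simp add: compose_eq)
    thus ?thesis
      using Gal.m_closed[OF \<rho> that] by (auto simp: Gal_orbit_def)
  qed
  thus "\<rho> ` Gal_orbit a \<subseteq> Gal_orbit a"
    by (auto simp: Gal_orbit_def)
qed

lemma coeff_prod_Gal_orbit_mem:
  assumes "a \<in> M"
  shows "coeff (\<Prod>b\<in>Gal_orbit a. [:- b, 1:]) i \<in> K"
proof (rule mem_base_if_Gal_fixed)
  let ?P = "\<Prod>b\<in>Gal_orbit a. [:- b, 1:]"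
  have "\<rho> (coeff ?P i) = coeff ?P i" if \<rho>: "\<rho> \<in> carrier (Gal K M)" for \<rho>
  proof -
    have inj: "inj_on \<rho> (Gal_orbit a)"
      using Gal_inj_on[OF \<rho>] Gal_orbit_subset[OF assms] by (rule inj_on_subset)
    have "map_poly \<rho> ?P = (\<Prod>b\<in>Gal_orbit a. [:- \<rho> b, 1:])"
      by (rule Gal_map_poly_prod_linear[OF \<rho> Gal_orbit_subset[OF assms]])
    also have "\<dots> = (\<Prod>b\<in>\<rho> ` Gal_orbit a. [:- b, 1:])"
      by (simp add: prod.reindex[OF inj])
    finally show ?thesis
      using Gal_image_orbit[OF \<rho> assms] by (metis coeff_map_poly Gal_zero[OF \<rho>])
  qed
  thus "\<rho> (coeff ?P i) = coeff ?P i" if "\<rho> \<in> carrier (Gal K M)" for \<rho>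
    using that by blast
  show "coeff ?P i \<in> M"
    by (rule L.coeff_prod_linear_mem[OF Gal_orbit_subset[OF assms]])
qed

end

locale galois_subextension = complex_extension K L + M: complex_galois_extension K M
  for K L M :: "complex set" +
  assumes intermediate_subset: "M \<subseteq> L"
begin

lemma Gal_maps_galois_subextension:
  assumes \<sigma>: "\<sigma> \<in> carrier (Gal K L)" and "a \<in> M"
  shows "\<sigma> a \<in> M"
proof -
  define P where "P = (\<Prod>b\<in>M.Gal_orbit a. [:- b, 1:])"
  have roots: "poly P x = 0 \<longleftrightarrow> x \<in> M.Gal_orbit a" for x
    using M.finite_Gal_orbit[OF \<open>a \<in> M\<close>] by (auto simp: P_def poly_prod)
  have "poly P (\<sigma> a) = \<sigma> (poly P a)"
    using Gal_poly_base[OF \<sigma>, of a P] \<open>a \<in> M\<close> intermediate_subset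
      M.coeff_prod_Gal_orbit_mem[OF \<open>a \<in> M\<close>] by (auto simp: P_def)
  hence "\<sigma> a \<in> M.Gal_orbit a"
    using M.self_mem_Gal_orbit[OF \<open>a \<in> M\<close>] Gal_zero[OF \<sigma>] by (simp flip: roots)
  thus ?thesis
    using M.Gal_orbit_subset[OF \<open>a \<in> M\<close>] by blast
qed

lemma restrict_Gal:
  assumes \<sigma>: "\<sigma> \<in> carrier (Gal K L)"
  shows "restrict \<sigma> M \<in> carrier (Gal K M)"
proof -
  have "x \<in> \<sigma> ` M" if x: "x \<in> M" for x
  proof -
    let ?\<iota> = "inv\<^bsub>Gal K L\<^esub> \<sigma>"
    have \<iota>: "?\<iota> \<in> carrier (Gal K L)" using \<sigma> by simp
    have "x \<in> L" using x intermediate_subset by blast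
    hence "\<sigma> (?\<iota> x) = (\<sigma> \<otimes>\<^bsub>Gal K L\<^esub> ?\<iota>) x"
      by (simp add: mult_Gal[OF \<sigma> \<iota>] compose_eq)
    also have "\<dots> = x"
      using \<sigma> \<open>x \<in> L\<close> by (simp add: one_Gal)
    finally show ?thesis
      using Gal_maps_galois_subextension[OF \<iota> x] by (metis imageI)
  qed
  hence "\<sigma> ` M = M"
    using Gal_maps_galois_subextension[OF \<sigma>] by blast
  moreover have "inj_on \<sigma> M"
    using Gal_inj_on[OF \<sigma>] intermediate_subset by (rule inj_on_subset)
  ultimately have "restrict \<sigma> M \<in> Bij M"
    by (simp add: Bij_def bij_betw_def)
  thus ?thesis
    using \<sigma> intermediate_subset M.base_subset by (auto simp: mem_Gal_iff subset_iff)
qed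

lemma restrict_Gal_hom: "(\<lambda>\<sigma>. restrict \<sigma> M) \<in> hom (Gal K L) (Gal K M)"
proof (rule homI)
  fix \<sigma> \<rho> assume \<sigma>: "\<sigma> \<in> carrier (Gal K L)" and \<rho>: "\<rho> \<in> carrier (Gal K L)"
  have "restrict (compose L \<sigma> \<rho>) M = compose M (restrict \<sigma> M) (restrict \<rho> M)"
    using Gal_maps_galois_subextension[OF \<rho>] intermediate_subset
    by (auto simp: compose_def fun_eq_iff)
  thus "restrict (\<sigma> \<otimes>\<^bsub>Gal K L\<^esub> \<rho>) M = restrict \<sigma> M \<otimes>\<^bsub>Gal K M\<^esub> restrict \<rho> M"
    by (simp add: mult_Gal \<sigma> \<rho> restrict_Gal)
qed (rule restrict_Gal)

lemma restrict_Gal_pow: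
  "\<sigma> \<in> carrier (Gal K L) \<Longrightarrow>
    restrict (\<sigma> [^]\<^bsub>Gal K L\<^esub> (k :: nat)) M = restrict \<sigma> M [^]\<^bsub>Gal K M\<^esub> k"
  by (rule hom_nat_pow[OF restrict_Gal_hom _ Gal.group_axioms M.Gal.group_axioms])

lemma restrict_eq_one_iff:
  assumes "\<sigma> \<in> carrier (Gal K L)"
  shows "restrict \<sigma> M = \<one>\<^bsub>Gal K M\<^esub> \<longleftrightarrow> (\<forall>x\<in>M. \<sigma> x = x)"
  using M.Gal_eq_one_iff[OF restrict_Gal[OF assms]] by simp

end

lemma galois_subextension_compositum:
  assumes "galois_extension K M" and "galois_extension K N"
  shows "galois_subextension K (compositum M N) M" and "galois_subextension K (compositum M N) N"
proof -
  interpret M: complex_galois_extension K M by unfold_locales fact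
  interpret N: complex_galois_extension K N by unfold_locales fact
  interpret L: complex_subfield "compositum M N"
    unfolding compositum_def by (rule complex_subfield_generate_field)
  have "M \<union> N \<subseteq> compositum M N"
    by (auto simp: compositum_def intro: generate_field.incl)
  thus "galois_subextension K (compositum M N) M" "galois_subextension K (compositum M N) N"
    using M.base_subset by unfold_locales auto
qed

lemma Gal_compositum_eq_one_iff:
  assumes M: "galois_extension K M" and N: "galois_extension K N"
    and \<sigma>: "\<sigma> \<in> carrier (Gal K (compositum M N))"
  shows "\<sigma> = \<one>\<^bsub>Gal K (compositum M N)\<^esub> \<longleftrightarrow>
    restrict \<sigma> M = \<one>\<^bsub>Gal K M\<^esub> \<and> restrict \<sigma> N = \<one>\<^bsub>Gal K N\<^esub>"
proof -
  let ?L = "compositum M N"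
  interpret M: galois_subextension K ?L M
    by (rule galois_subextension_compositum[OF M N])
  interpret N: galois_subextension K ?L N
    by (rule galois_subextension_compositum[OF M N])
  have "\<sigma> x = x" if fixed: "\<And>x. x \<in> M \<union> N \<Longrightarrow> \<sigma> x = x" and "x \<in> ?L" for x
  proof -
    have "x \<in> generate_field CC (M \<union> N)"
      using \<open>x \<in> ?L\<close> by (simp add: compositum_def)
    hence "x \<in> ?L \<and> \<sigma> x = x"
    proof induction
      case (incl x)
      thus ?case
        using fixed M.intermediate_subset N.intermediate_subset by blast
    qed (simp_all add: M.Gal_zero[OF \<sigma>] Gal_one[OF \<sigma>] Gal_add[OF \<sigma>] Gal_mult[OF \<sigma>]
      M.Gal_uminus[OF \<sigma>] M.Gal_inverse[OF \<sigma>])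
    thus ?thesis ..
  qed
  hence "\<sigma> = \<one>\<^bsub>Gal K ?L\<^esub> \<longleftrightarrow> (\<forall>x\<in>M. \<sigma> x = x) \<and> (\<forall>x\<in>N. \<sigma> x = x)"
    using M.Gal_eq_one_iff[OF \<sigma>] M.intermediate_subset N.intermediate_subset by blast
  thus ?thesis
    by (simp add: M.restrict_eq_one_iff[OF \<sigma>] N.restrict_eq_one_iff[OF \<sigma>])
qed


subsection \<open>Groups of ideals\<close>

lemma ideal_group_simps [simp]:
  "I \<otimes>\<^bsub>ideal_group K m\<^esub> J = ideal_prod CC I J" "\<one>\<^bsub>ideal_group K m\<^esub> = \<O>\<^bsub>K\<^esub>"
  by (simp_all add: ideal_group_def)

context complex_subfield
begin

lemma ints_ideal_prod_fractional_ideal: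
  assumes "fractional_ideal K I"
  shows "ideal_prod CC \<O>\<^bsub>K\<^esub> I = I"
proof
  from assms obtain c where "c \<noteq> 0" and c: "ideal ((\<lambda>x. c * x) ` I) (ring_of_ints K)"
    by (auto simp: fractional_ideal_def)
  show "ideal_prod CC \<O>\<^bsub>K\<^esub> I \<subseteq> I"
  proof (rule ideal_prod_CC_subset)
    fix r x assume "r \<in> \<O>\<^bsub>K\<^esub>" "x \<in> I"
    hence "c * (r * x) \<in> (\<lambda>x. c * x) ` I"
      using ideal_mult_left[OF c, of r "c * x"] imageI[of x I "\<lambda>x. c * x"]
      by (simp add: mult.left_commute)
    thus "r * x \<in> I" using \<open>c \<noteq> 0\<close> by auto
  next
    fix x y assume "x \<in> I" "y \<in> I"
    hence "c * (x + y) \<in> (\<lambda>x. c * x) ` I"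
      using ideal_add[OF c, of "c * x" "c * y"] imageI[of _ I "\<lambda>x. c * x"]
      by (simp add: distrib_left)
    thus "x + y \<in> I" using \<open>c \<noteq> 0\<close> by auto
  qed
  show "I \<subseteq> ideal_prod CC \<O>\<^bsub>K\<^esub> I"
    using ideal_prod_CC_mult[OF ints_one] by fastforce
qed

lemma fractional_ideal_if_ideal:
  "ideal I (ring_of_ints K) \<Longrightarrow> I \<noteq> {0} \<Longrightarrow> fractional_ideal K I"
  unfolding fractional_ideal_def
  using ideal_subset_ints[of I] ints_subset_field[of K] by (intro conjI bexI[of _ 1]) auto

lemma ideal_groupI:
  assumes "fractional_ideal K I" and "ideal_prod CC I B = A"
    and "ideal A (ring_of_ints K)" "A \<noteq> {0}" "comaximal K A m"
    and "ideal B (ring_of_ints K)" "B \<noteq> {0}" "comaximal K B m"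
  shows "I \<in> carrier (ideal_group K m)"
  using assms unfolding ideal_group_def by auto

lemma ideal_in_ideal_group:
  assumes "ideal m (ring_of_ints K)" and "ideal I (ring_of_ints K)" and "I \<noteq> {0}"
    and "comaximal K I m"
  shows "I \<in> carrier (ideal_group K m)"
  by (rule ideal_groupI[OF _ ideal_ints_prod])
    (use assms fractional_ideal_if_ideal ideal_ints ints_ne_zero comaximal_ints in auto)

lemma principal_ideal_inverse_in_ideal_group:
  assumes m: "ideal m (ring_of_ints K)"
    and a: "a \<in> \<O>\<^bsub>K\<^esub>" "a \<noteq> 0" "comaximal K (principal_ideal K a) m"
  shows "principal_ideal K (inverse a) \<in> carrier (ideal_group K m)"
proof -
  have "principal_ideal K (inverse a) \<subseteq> K"
    using a(1) by (auto simp: mem_principal_ideal_iff mem_ints_iff)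
  moreover have "(\<lambda>x. a * x) ` principal_ideal K (inverse a) = \<O>\<^bsub>K\<^esub>"
    using a(2) by (simp add: image_mult_principal_ideal)
  ultimately have "fractional_ideal K (principal_ideal K (inverse a))"
    using a ideal_ints principal_ideal_ne_zero[of "inverse a"]
    unfolding fractional_ideal_def by (metis nonzero_imp_inverse_nonzero)
  thus ?thesis
  proof (rule ideal_groupI)
    show "ideal_prod CC (principal_ideal K (inverse a)) (principal_ideal K a) = \<O>\<^bsub>K\<^esub>"
      using a(2) by (simp add: ideal_prod_principal_ideal)
  qed (use a m ideal_ints ints_ne_zero comaximal_ints ideal_principal_ideal
      principal_ideal_ne_zero in auto)
qed

lemma inv_principal_ideal:
  assumes m: "ideal m (ring_of_ints K)"
    and a: "a \<in> \<O>\<^bsub>K\<^esub>" "a \<noteq> 0" "comaximal K (principal_ideal K a) m"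
  shows "inv\<^bsub>ideal_group K m\<^esub> (principal_ideal K a) = principal_ideal K (inverse a)"
  unfolding m_inv_def
proof (rule the_equality)
  show "principal_ideal K (inverse a) \<in> carrier (ideal_group K m) \<and>
    principal_ideal K a \<otimes>\<^bsub>ideal_group K m\<^esub> principal_ideal K (inverse a) = \<one>\<^bsub>ideal_group K m\<^esub> \<and>
    principal_ideal K (inverse a) \<otimes>\<^bsub>ideal_group K m\<^esub> principal_ideal K a = \<one>\<^bsub>ideal_group K m\<^esub>"
    using a(2) by (simp add: principal_ideal_inverse_in_ideal_group[OF assms]
        ideal_prod_principal_ideal)
next
  fix J assume "J \<in> carrier (ideal_group K m) \<and>
    principal_ideal K a \<otimes>\<^bsub>ideal_group K m\<^esub> J = \<one>\<^bsub>ideal_group K m\<^esub> \<and>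
    J \<otimes>\<^bsub>ideal_group K m\<^esub> principal_ideal K a = \<one>\<^bsub>ideal_group K m\<^esub>"
  hence "fractional_ideal K J" and J: "ideal_prod CC (principal_ideal K a) J = \<O>\<^bsub>K\<^esub>"
    by (auto simp: ideal_group_def)
  hence "J = ideal_prod CC (principal_ideal K (inverse a * a)) J"
    using a(2) by (simp add: ints_ideal_prod_fractional_ideal)
  also have "\<dots> = ideal_prod CC (principal_ideal K (inverse a)) (principal_ideal K 1)"
    by (simp only: ideal_prod_principal_ideal[symmetric] ideal_prod_CC_assoc J principal_ideal_one)
  also have "\<dots> = principal_ideal K (inverse a)"
    by (simp only: ideal_prod_principal_ideal mult_1_right)
  finally show "J = principal_ideal K (inverse a)" .
qed

end

text \<open>\<open>S\<close> is the preimage of a subgroup of the unit group of the residue ring modulo \<open>m\<close>.\<close>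
locale residue_unit_group = complex_subfield +
  fixes m S :: "complex set"
  assumes modulus: "ideal m (ring_of_ints K)"
    and residues_subset: "S \<subseteq> \<O>\<^bsub>K\<^esub>"
    and residues_one: "1 \<in> S"
    and residues_mult: "a \<in> S \<Longrightarrow> b \<in> S \<Longrightarrow> a * b \<in> S"
    and residues_inverse: "a \<in> S \<Longrightarrow> \<exists>b\<in>S. a * b - 1 \<in> m"
    and residues_cong: "a \<in> S \<Longrightarrow> b \<in> \<O>\<^bsub>K\<^esub> \<Longrightarrow> b - a \<in> m \<Longrightarrow> b \<in> S"
begin

lemma comaximal_principal_ideal:
  assumes "a \<in> S"
  shows "comaximal K (principal_ideal K a) m"
proof -
  obtain b where "b \<in> S" "a * b - 1 \<in> m"
    using residues_inverse[OF assms] by blast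
  thus ?thesis
    using assms residues_subset modulus ideal_principal_ideal[of a]
      ideal_uminus[OF modulus, of "a * b - 1"] mult_mem_principal_ideal[of b K a]
    by (intro comaximalI[of _ _ "b * a" "- (a * b - 1)"]) auto
qed

lemma inv_principal_ideal_of_residue:
  assumes "a \<in> S" and "a \<noteq> 0"
  shows "inv\<^bsub>ideal_group K m\<^esub> (principal_ideal K a) = principal_ideal K (inverse a)"
  using assms residues_subset by (intro inv_principal_ideal modulus comaximal_principal_ideal) auto

lemma generate_principal_ideals:
  "generate (ideal_group K m) {principal_ideal K a | a. a \<in> S \<and> a \<noteq> 0} =
    {principal_ideal K (a / b) | a b. a \<in> S \<and> b \<in> S \<and> a \<noteq> 0 \<and> b \<noteq> 0}" (is "?G = ?F")
proof
  have F: "principal_ideal K (a / b) \<in> ?F" if "a \<in> S" "b \<in> S" "a \<noteq> 0" "b \<noteq> 0" for a b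
    using that by blast
  show "?G \<subseteq> ?F"
  proof
    fix I assume "I \<in> ?G"
    thus "I \<in> ?F"
    proof induction
      case one
      show ?case using F[OF residues_one residues_one] by simp
    next
      case (incl I)
      thus ?case using F[of _ 1] residues_one by auto
    next
      case (inv I)
      thus ?case
        using F[of 1] residues_one by (auto simp: inv_principal_ideal_of_residue inverse_eq_divide)
    next
      case (eng I J)
      then obtain a b c e where
        "I = principal_ideal K (a / b)" "J = principal_ideal K (c / e)"
        "a \<in> S" "b \<in> S" "c \<in> S" "e \<in> S" "a \<noteq> 0" "b \<noteq> 0" "c \<noteq> 0" "e \<noteq> 0"
        by blast
      thus ?case
        using F[of "a * c" "b * e"] by (simp add: residues_mult ideal_prod_principal_ideal)
    qed
  qed
  show "?F \<subseteq> ?G"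
  proof safe
    fix a b assume ab: "a \<in> S" "b \<in> S" "a \<noteq> 0" "b \<noteq> 0"
    hence "principal_ideal K a \<otimes>\<^bsub>ideal_group K m\<^esub> inv\<^bsub>ideal_group K m\<^esub> (principal_ideal K b) \<in> ?G"
      by (intro generate.eng generate.incl generate.inv) auto
    thus "principal_ideal K (a / b) \<in> ?G"
      using ab by (simp add: inv_principal_ideal_of_residue ideal_prod_principal_ideal
          divide_inverse)
  qed
qed

text \<open>If \<open>b b' \<equiv> 1\<close> and \<open>a / b\<close> is integral, then \<open>a / b \<equiv> (a / b) b b' = a b'\<close>.\<close>
lemma quotient_mem:
  assumes "a \<in> S" and "b \<in> S" and "b \<noteq> 0" and q: "a / b \<in> \<O>\<^bsub>K\<^esub>"
  shows "a / b \<in> S"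
proof -
  obtain b' where b': "b' \<in> S" "b * b' - 1 \<in> m"
    using residues_inverse[OF \<open>b \<in> S\<close>] by blast
  have "- ((a / b) * (b * b' - 1)) \<in> m"
    by (intro ideal_uminus[OF modulus] ideal_mult_left[OF modulus] q b')
  also have "- ((a / b) * (b * b' - 1)) = a / b - a * b'"
    using \<open>b \<noteq> 0\<close> by (simp add: field_simps)
  finally show ?thesis
    using residues_cong[OF residues_mult[OF \<open>a \<in> S\<close> b'(1)] q] by simp
qed

lemma mem_generate_principal_ideals_iff:
  assumes I: "ideal I (ring_of_ints K)" "I \<noteq> {0}"
  shows "I \<in> generate (ideal_group K m) {principal_ideal K a | a. a \<in> S \<and> a \<noteq> 0} \<longleftrightarrow>
    (\<exists>a\<in>S. I = principal_ideal K a)"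
  unfolding generate_principal_ideals
proof
  assume "I \<in> {principal_ideal K (a / b) | a b. a \<in> S \<and> b \<in> S \<and> a \<noteq> 0 \<and> b \<noteq> 0}"
  then obtain a b where "I = principal_ideal K (a / b)" "a \<in> S" "b \<in> S" "b \<noteq> 0"
    by blast
  thus "\<exists>a\<in>S. I = principal_ideal K a"
    using quotient_mem mem_ints_if_principal_ideal_subset ideal_subset_ints[OF I(1)] by metis
next
  assume "\<exists>a\<in>S. I = principal_ideal K a"
  then obtain a where a: "a \<in> S" "I = principal_ideal K a" by blast
  have "a \<noteq> 0"
    using I(2) a(2) principal_ideal_zero by auto
  thus "I \<in> {principal_ideal K (a / b) | a b. a \<in> S \<and> b \<in> S \<and> a \<noteq> 0 \<and> b \<noteq> 0}"
    using a residues_one by (intro CollectI exI[of _ a] exI[of _ 1]) simp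
qed

end


subsection \<open>Ray and ring subgroups\<close>

definition ray_residues :: "complex set \<Rightarrow> complex set \<Rightarrow> complex set"
  where "ray_residues K m = {a \<in> \<O>\<^bsub>K\<^esub>. a - 1 \<in> m}"

definition ring_residues :: "complex set \<Rightarrow> nat \<Rightarrow> complex set"
  where "ring_residues K f = {a \<in> \<O>\<^bsub>K\<^esub>.
    \<exists>c :: int. coprime c (int f) \<and> a - of_int c \<in> principal_ideal K (of_nat f)}"

lemma ray_subgroup_eq:
  "ray_subgroup K m =
    generate (ideal_group K m) {principal_ideal K a | a. a \<in> ray_residues K m \<and> a \<noteq> 0}"
  by (simp add: ray_subgroup_def ray_residues_def conj_ac)

lemma ring_subgroup_eq:
  "ring_subgroup K f = generate (ideal_group K (principal_ideal K (of_nat f)))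
    {principal_ideal K a | a. a \<in> ring_residues K f \<and> a \<noteq> 0}"
  by (simp add: ring_subgroup_def ring_residues_def conj_ac)

context complex_subfield
begin

lemma residue_unit_group_ray:
  assumes m: "ideal m (ring_of_ints K)"
  shows "residue_unit_group K m (ray_residues K m)"
  unfolding ray_residues_def
proof (intro residue_unit_group.intro residue_unit_group_axioms.intro)
  let ?S = "{a \<in> \<O>\<^bsub>K\<^esub>. a - 1 \<in> m}"
  show "1 \<in> ?S"
    by (simp add: ideal_zero[OF m])
  show "a * b \<in> ?S" if "a \<in> ?S" "b \<in> ?S" for a b
    using that ideal_add[OF m ideal_mult_left[OF m, of a "b - 1"], of "a - 1"]
    by (simp add: algebra_simps)
  show "\<exists>b\<in>?S. a * b - 1 \<in> m" if "a \<in> ?S" for a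
    using that ideal_zero[OF m] by (intro bexI[of _ 1]) simp_all
  show "b \<in> ?S" if "a \<in> ?S" "b \<in> \<O>\<^bsub>K\<^esub>" "b - a \<in> m" for a b
    using that ideal_add[OF m, of "b - a" "a - 1"] by simp
qed (use m complex_subfield_axioms in auto)

lemma mem_ray_subgroup_iff:
  assumes m: "ideal m (ring_of_ints K)" and I: "ideal I (ring_of_ints K)" "I \<noteq> {0}"
  shows "I \<in> ray_subgroup K m \<longleftrightarrow> (\<exists>\<alpha>. I = principal_ideal K \<alpha> \<and> \<alpha> - 1 \<in> m)"
  using residue_unit_group.mem_generate_principal_ideals_iff[OF residue_unit_group_ray[OF m] I]
    ideal_subset_ints[OF I(1)] mem_ints_if_principal_ideal_subset
  by (auto simp: ray_subgroup_eq ray_residues_def)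

lemma int_inverse_mod_principal_ideal:
  assumes "coprime c (int f)" and "a - of_int c \<in> principal_ideal K (of_nat f)"
  obtains u :: int where "coprime u (int f)" "a * of_int u - 1 \<in> principal_ideal K (of_nat f)"
proof -
  have m: "ideal (principal_ideal K (of_nat f)) (ring_of_ints K)"
    by (simp add: ideal_principal_ideal)
  obtain u where u: "[c * u = 1] (mod int f)" "coprime u (int f)"
    using assms(1) by (metis cong_solve_coprime_int coprime_iff_invertible_int mult.commute)
  obtain z where z: "c * u - 1 = int f * z"
    using u(1) by (auto simp: cong_iff_dvd_diff)
  have "of_int u * (a - of_int c) + of_int z * of_nat f \<in> principal_ideal K (of_nat f)"
    by (intro ideal_add[OF m] ideal_mult_left[OF m] assms(2) mult_mem_principal_ideal) simp_all
  also have "of_int z * of_nat f = of_int (c * u) - (1 :: complex)"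
    using arg_cong[OF z, of "of_int :: int \<Rightarrow> complex"] by (simp add: mult.commute)
  finally have "a * of_int u - 1 \<in> principal_ideal K (of_nat f)"
    by (simp add: algebra_simps)
  thus ?thesis
    using that u(2) by blast
qed

lemma residue_unit_group_ring:
  "residue_unit_group K (principal_ideal K (of_nat f)) (ring_residues K f)"
  unfolding ring_residues_def
proof (intro residue_unit_group.intro residue_unit_group_axioms.intro)
  let ?m = "principal_ideal K (of_nat f)"
  let ?S = "{a \<in> \<O>\<^bsub>K\<^esub>. \<exists>c :: int. coprime c (int f) \<and> a - of_int c \<in> ?m}"
  show m: "ideal ?m (ring_of_ints K)"
    by (simp add: ideal_principal_ideal)
  show "1 \<in> ?S"
    by (auto simp: ideal_zero[OF m] intro!: exI[of _ 1])
  show "a * b \<in> ?S" if ab: "a \<in> ?S" "b \<in> ?S" for a b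
  proof -
    from ab obtain c e where c: "coprime c (int f)" "a - of_int c \<in> ?m"
      and e: "coprime e (int f)" "b - of_int e \<in> ?m" by blast
    have "a * (b - of_int e) + of_int e * (a - of_int c) \<in> ?m"
      using ab c e by (intro ideal_add[OF m] ideal_mult_left[OF m]) auto
    hence "a * b - of_int (c * e) \<in> ?m" by (simp add: algebra_simps)
    thus ?thesis
      using ab c e by (auto intro!: exI[of _ "c * e"])
  qed
  show "\<exists>b\<in>?S. a * b - 1 \<in> ?m" if a: "a \<in> ?S" for a
  proof -
    from a obtain u where u: "coprime u (int f)" "a * of_int u - 1 \<in> ?m"
      using int_inverse_mod_principal_ideal by blast
    thus ?thesis
      using ideal_zero[OF m] by (intro bexI[of _ "of_int u"]) auto
  qed
  show "b \<in> ?S" if a: "a \<in> ?S" and b: "b \<in> \<O>\<^bsub>K\<^esub>" "b - a \<in> ?m" for a b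
  proof -
    from a obtain c where c: "coprime c (int f)" "a - of_int c \<in> ?m" by blast
    thus ?thesis
      using b ideal_add[OF m b(2) c(2)] by auto
  qed
qed (use complex_subfield_axioms in auto)

lemma mem_ring_subgroup_iff:
  assumes I: "ideal I (ring_of_ints K)" "I \<noteq> {0}"
  shows "I \<in> ring_subgroup K f \<longleftrightarrow> (\<exists>\<alpha>. I = principal_ideal K \<alpha> \<and>
    (\<exists>c :: int. coprime c (int f) \<and> \<alpha> - of_int c \<in> principal_ideal K (of_nat f)))"
  using residue_unit_group.mem_generate_principal_ideals_iff[OF residue_unit_group_ring I]
    ideal_subset_ints[OF I(1)] mem_ints_if_principal_ideal_subset
  by (auto simp: ring_subgroup_eq ring_residues_def)

lemma coprime_if_quadratic_order_generator:
  assumes \<alpha>: "\<alpha> = of_int a + of_nat f * w" and w: "w \<in> \<O>\<^bsub>K\<^esub>"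
    and "comaximal K (principal_ideal K \<alpha>) (principal_ideal K (of_nat f))"
  shows "coprime a (int f)"
proof (rule coprimeI)
  fix g assume "g dvd a" "g dvd int f"
  then obtain a' f' where g: "a = g * a'" "int f = g * f'" by (auto elim!: dvdE)
  have "(of_nat f :: complex) = of_int (int f)" by simp
  hence f: "(of_nat f :: complex) = of_int g * of_int f'" by (simp only: g of_int_mult)
  have "\<alpha> \<in> \<O>\<^bsub>K\<^esub>" using \<alpha> w by simp
  then obtain r t where rt: "r \<in> \<O>\<^bsub>K\<^esub>" "t \<in> \<O>\<^bsub>K\<^esub>" "r * \<alpha> + t * of_nat f = 1"
    using assms(3) comaximal_iff[OF ideal_principal_ideal ideal_principal_ideal, of \<alpha> "of_nat f"]
    by (auto simp: mem_principal_ideal_iff)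
  have "of_int 1 = r * \<alpha> + t * of_nat f" using rt(3) by simp
  also have "\<dots> = of_int g * (r * (of_int a' + of_int f' * w) + t * of_int f')"
    by (simp add: \<alpha> f g(1) algebra_simps)
  finally show "is_unit g"
    using rt w of_int_dvd_if_algebraic_int[of 1 g]
    by (metis ints_add ints_mult ints_of_int mem_ints_iff)
qed

lemma mem_ring_subgroup_iff_quadratic_order:
  assumes I: "ideal I (ring_of_ints K)" "I \<noteq> {0}"
    and "comaximal K I (principal_ideal K (of_nat f))"
  shows "I \<in> ring_subgroup K f \<longleftrightarrow> (\<exists>\<alpha>\<in>quadratic_order K f. I = principal_ideal K \<alpha>)"
proof
  assume "I \<in> ring_subgroup K f"
  then obtain \<alpha> c w where "I = principal_ideal K \<alpha>" "w \<in> \<O>\<^bsub>K\<^esub>" "\<alpha> - of_int c = w * of_nat f"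
    unfolding mem_ring_subgroup_iff[OF I] mem_principal_ideal_iff by blast
  moreover from this have "\<alpha> = of_int c + of_nat f * w"
    by (simp add: algebra_simps)
  ultimately show "\<exists>\<alpha>\<in>quadratic_order K f. I = principal_ideal K \<alpha>"
    by (auto simp: quadratic_order_def)
next
  assume "\<exists>\<alpha>\<in>quadratic_order K f. I = principal_ideal K \<alpha>"
  then obtain \<alpha> a w where \<alpha>: "I = principal_ideal K \<alpha>" "\<alpha> = of_int a + of_nat f * w" "w \<in> \<O>\<^bsub>K\<^esub>"
    by (auto simp: quadratic_order_def)
  moreover have "coprime a (int f)"
    using coprime_if_quadratic_order_generator \<alpha> assms(3) by blast
  moreover have "\<alpha> - of_int a \<in> principal_ideal K (of_nat f)"
    using \<alpha>(2,3) mult_mem_principal_ideal[of w K "of_nat f"] by (simp add: mult.commute)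
  ultimately show "I \<in> ring_subgroup K f"
    unfolding mem_ring_subgroup_iff[OF I] by blast
qed

end


subsection \<open>Primes above and restriction of Artin symbols\<close>

lemma (in cring) exists_maximalideal:
  assumes "ideal J R" and "\<one> \<notin> J"
  obtains M where "maximalideal M R" and "J \<subseteq> M"
proof -
  define A where "A = {I. ideal I R \<and> J \<subseteq> I \<and> \<one> \<notin> I}"
  have "\<exists>M\<in>A. \<forall>I\<in>A. M \<subseteq> I \<longrightarrow> I = M"
  proof (rule subset_Zorn_nonempty)
    show "A \<noteq> {}" using assms by (auto simp: A_def)
    fix C assume C: "C \<noteq> {}" "subset.chain A C"
    hence "ideal (\<Union>C) R"
      using chain_Union_is_ideal[of C] by (auto simp: subset_chain_def A_def)
    moreover have "C \<subseteq> A"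
      using C(2) by (simp add: subset_chain_def)
    hence "J \<subseteq> \<Union>C" "\<one> \<notin> \<Union>C"
      using C(1) unfolding A_def by blast+
    ultimately show "\<Union>C \<in> A" by (simp add: A_def)
  qed
  then obtain M where M: "M \<in> A" "\<And>I. I \<in> A \<Longrightarrow> M \<subseteq> I \<Longrightarrow> I = M" by blast
  have "maximalideal M R"
  proof (rule maximalidealI)
    show "ideal M R" "carrier R \<noteq> M"
      using M(1) by (auto simp: A_def)
    show "I = M \<or> I = carrier R" if "ideal I R" "M \<subseteq> I" for I
      using that M ideal.one_imp_carrier[OF that(1)] by (cases "\<one> \<in> I") (auto simp: A_def)
  qed
  thus ?thesis
    using that M(1) by (simp add: A_def)
qed

context complex_subfield
begin

lemma of_int_invertible_mod_ideal:
  fixes l c :: int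
  assumes Q: "ideal Q (ring_of_ints K)" and l: "prime l" "of_int l \<in> Q" and "of_int c \<notin> Q"
  obtains v where "of_int (v * c) - 1 \<in> Q"
proof -
  have "\<not> l dvd c"
    using ideal_mult_right[OF Q ints_of_int l(2)] \<open>of_int c \<notin> Q\<close> by (auto elim!: dvdE)
  hence "coprime l c"
    using l(1) prime_imp_coprime by blast
  then obtain u v where "u * l + v * c = 1"
    using bezout_int[of l c] by (auto simp: coprime_iff_gcd_eq_1)
  hence "of_int (v * c) - 1 = - (of_int u * (of_int l :: complex))"
    by (metis add_diff_cancel_right' minus_diff_eq of_int_1 of_int_diff of_int_minus of_int_mult)
  thus ?thesis
    using that ideal_uminus[OF Q ideal_mult_left[OF Q ints_of_int l(2)]] by metis
qed

lemma poly_of_int_mem_ints: "x \<in> \<O>\<^bsub>K\<^esub> \<Longrightarrow> poly (map_poly of_int g) x \<in> \<O>\<^bsub>K\<^esub>"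
  by (induction g) simp_all

text \<open>
  If the constant term of the monic relation lies in \<open>Q\<close>, the relation can be divided by \<open>x\<close>;
  otherwise the constant term is invertible modulo \<open>Q\<close>, and so is \<open>x\<close>.
\<close>
lemma invertible_mod_primeideal_if_monic_relation:
  fixes l :: int and g :: "int poly"
  assumes Q: "primeideal Q (ring_of_ints K)" and l: "prime l" "of_int l \<in> Q"
    and x: "x \<in> \<O>\<^bsub>K\<^esub>" "x \<notin> Q"
    and "lead_coeff g = 1" and "poly (map_poly of_int g) x \<in> Q"
  shows "\<exists>y\<in>\<O>\<^bsub>K\<^esub>. x * y - 1 \<in> Q"
  using assms(6,7)
proof (induction g)
  case (pCons c g)
  note ideal_Q = primeideal_is_ideal[OF Q]
  let ?y = "poly (map_poly of_int g) x"
  have relation: "of_int c + x * ?y \<in> Q"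
    using pCons.prems(2) by (simp add: of_int_hom.map_poly_pCons_hom)
  show ?case
  proof (cases "of_int c \<in> Q")
    case True
    hence "x * ?y \<in> Q"
      using ideal_diff[OF ideal_Q relation] by fastforce
    hence "?y \<in> Q"
      using primeideal_mult[OF Q x(1) poly_of_int_mem_ints[OF x(1)]] x(2) by blast
    moreover have "g \<noteq> 0"
      using True pCons.prems(1) one_notin_primeideal[OF Q] by auto
    ultimately show ?thesis
      using pCons.IH pCons.prems(1) by simp
  next
    case False
    then obtain v where v: "of_int (v * c) - 1 \<in> Q"
      using of_int_invertible_mod_ideal[OF ideal_Q l] by blast
    have "of_int (v * c) - 1 - of_int v * (of_int c + x * ?y) \<in> Q"
      by (intro ideal_diff[OF ideal_Q] ideal_mult_left[OF ideal_Q] v relation ints_of_int)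
    also have "of_int (v * c) - 1 - of_int v * (of_int c + x * ?y) = x * (- of_int v * ?y) - 1"
      by (simp add: algebra_simps)
    finally show ?thesis
      using poly_of_int_mem_ints[OF x(1), of g] by (intro bexI[of _ "- of_int v * ?y"]) simp_all
  qed
qed simp

lemma invertible_mod_primeideal:
  fixes l :: int
  assumes Q: "primeideal Q (ring_of_ints K)" and l: "prime l" "of_int l \<in> Q"
    and x: "x \<in> \<O>\<^bsub>K\<^esub>" "x \<notin> Q"
  obtains y where "y \<in> \<O>\<^bsub>K\<^esub>" "x * y - 1 \<in> Q"
proof -
  obtain g :: "int poly" where "poly (map_poly of_int g) x = 0" "lead_coeff g = 1"
    using x(1) by (auto simp: mem_ints_iff algebraic_int_altdef_ipoly)
  thus ?thesis
    using that invertible_mod_primeideal_if_monic_relation[OF assms, of g]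
      ideal_zero[OF primeideal_is_ideal[OF Q]] by auto
qed

lemma maximalideal_if_primeideal:
  fixes l :: int
  assumes Q: "primeideal Q (ring_of_ints K)" and l: "prime l" "of_int l \<in> Q"
  shows "maximalideal Q (ring_of_ints K)"
proof (rule maximalidealI)
  show "ideal Q (ring_of_ints K)" "\<O>\<^bsub>K\<^esub> \<noteq> Q"
    using primeideal_is_ideal[OF Q] one_notin_primeideal[OF Q] ints_one by auto
  fix J assume J: "ideal J (ring_of_ints K)" "Q \<subseteq> J"
  have "J = \<O>\<^bsub>K\<^esub>" if x: "x \<in> J" "x \<notin> Q" for x
  proof -
    have "x \<in> \<O>\<^bsub>K\<^esub>" using x(1) ideal_subset_ints[OF J(1)] by blast
    then obtain y where y: "y \<in> \<O>\<^bsub>K\<^esub>" "x * y - 1 \<in> Q"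
      using invertible_mod_primeideal[OF Q l _ x(2)] by blast
    hence "x * y - (x * y - 1) \<in> J"
      using J x(1) by (blast intro: ideal_diff ideal_mult_right)
    thus ?thesis
      using ideal.one_imp_carrier[OF J(1)] by simp
  qed
  thus "J = Q \<or> J = \<O>\<^bsub>K\<^esub>"
    using J(2) by blast
qed

lemma comaximal_if_distinct_maximalideals:
  assumes P: "maximalideal P (ring_of_ints K)" and Q: "maximalideal Q (ring_of_ints K)"
    and "P \<noteq> Q"
  shows "comaximal K P Q"
proof (rule ccontr)
  let ?J = "P <+>\<^bsub>ring_of_ints K\<^esub> Q"
  note ideals = maximalideal.axioms(1)[OF P] maximalideal.axioms(1)[OF Q]
  have J: "ideal ?J (ring_of_ints K)"
    by (rule ints.add_ideals[OF ideals])
  have "P \<subseteq> ?J" "Q \<subseteq> ?J"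
    using ideal_zero ideals by (force simp: set_add_def')+
  moreover assume "\<not> comaximal K P Q"
  ultimately show False
    using maximalideal.I_maximal[OF P J] maximalideal.I_maximal[OF Q J] ideal_subset_ints[OF J]
      \<open>P \<noteq> Q\<close> by (auto simp: comaximal_def)
qed

end

context complex_extension
begin

lemma primeideal_contract:
  assumes P: "primeideal P (ring_of_ints L)"
  shows "primeideal (P \<inter> K) (ring_of_ints K)"
proof (rule primeidealI)
  note ideal_P = L.primeideal_is_ideal[OF P]
  have ints_subset: "\<O>\<^bsub>K\<^esub> \<subseteq> \<O>\<^bsub>L\<^esub>" by (rule ints_of_mono[OF base_subset])
  show "ideal (P \<inter> K) (ring_of_ints K)"
  proof (rule K.ideal_ring_of_intsI)
    show "P \<inter> K \<subseteq> \<O>\<^bsub>K\<^esub>"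
      using L.ideal_subset_ints[OF ideal_P] by (auto simp: mem_ints_iff)
    show "r * x \<in> P \<inter> K" if "r \<in> \<O>\<^bsub>K\<^esub>" "x \<in> P \<inter> K" for r x
      using that ints_subset L.ideal_mult_left[OF ideal_P] by (auto simp: mem_ints_iff)
  qed (simp_all add: L.ideal_zero[OF ideal_P] L.ideal_add[OF ideal_P])
  show "\<O>\<^bsub>K\<^esub> \<noteq> P \<inter> K"
    using L.one_notin_primeideal[OF P] K.ints_one by blast
  show "a \<in> P \<inter> K \<or> b \<in> P \<inter> K"
    if "a \<in> \<O>\<^bsub>K\<^esub>" "b \<in> \<O>\<^bsub>K\<^esub>" "a \<otimes>\<^bsub>ring_of_ints K\<^esub> b \<in> P \<inter> K" for a b
    using that ints_subset ints_subset_field L.primeideal_mult[OF P, of a b] by auto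
qed (rule K.ints.cring_axioms)

abbreviation extended_ideal :: "complex set \<Rightarrow> complex set"
  where "extended_ideal I \<equiv> ideal_prod CC \<O>\<^bsub>L\<^esub> I"

lemma extended_ideal_is_ideal:
  assumes "ideal I (ring_of_ints K)"
  shows "ideal (extended_ideal I) (ring_of_ints L)"
proof (rule L.ideal_ring_of_intsI)
  have "I \<subseteq> \<O>\<^bsub>L\<^esub>"
    using K.ideal_subset_ints[OF assms] ints_of_mono[OF base_subset] by blast
  thus "extended_ideal I \<subseteq> \<O>\<^bsub>L\<^esub>"
    by (intro ideal_prod_CC_subset) auto
  show "0 \<in> extended_ideal I"
    using ideal_prod_CC_mult[OF L.ints_zero K.ideal_zero[OF assms]] by simp
  show "r * x \<in> extended_ideal I" if "r \<in> \<O>\<^bsub>L\<^esub>" "x \<in> extended_ideal I" for r x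
    using ideal_prod_CC_mult[OF that] L.ideal_ints_prod[OF L.ideal_ints]
    by (simp flip: ideal_prod_CC_assoc)
qed (rule ideal_prod_CC_add)

text \<open>\<open>q = 1 q\<close> lies in the extension of \<open>p q = (a)\<close> to \<open>L\<close>.\<close>
lemma subset_principal_ideal_if_one_mem_extended_ideal:
  assumes one: "1 \<in> extended_ideal p"
    and pq: "ideal_prod CC p q = principal_ideal K a" and "a \<noteq> 0" "a \<in> K" "q \<subseteq> K"
  shows "q \<subseteq> principal_ideal K a"
proof
  fix b assume "b \<in> q"
  have "1 * b \<in> ideal_prod CC \<O>\<^bsub>L\<^esub> (principal_ideal K a)"
    using ideal_prod_CC_mult[OF one \<open>b \<in> q\<close>] by (simp add: ideal_prod_CC_assoc pq)
  also have "\<dots> \<subseteq> ideal_prod CC (principal_ideal L 1) (principal_ideal L a)"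
    using ints_of_mono[OF base_subset]
    by (intro ideal_prod_CC_subset ideal_prod_CC_mult ideal_prod_CC_add)
      (auto simp: mem_principal_ideal_iff)
  finally obtain r where r: "r \<in> \<O>\<^bsub>L\<^esub>" "b = r * a"
    by (auto simp: L.ideal_prod_principal_ideal mem_principal_ideal_iff
        simp del: principal_ideal_one)
  hence "r = b / a" using \<open>a \<noteq> 0\<close> by simp
  hence "r \<in> \<O>\<^bsub>K\<^esub>"
    using r(1) \<open>b \<in> q\<close> assms(4,5) by (auto simp: mem_ints_iff)
  thus "b \<in> principal_ideal K a"
    using r(2) by (simp add: mult_mem_principal_ideal)
qed

lemma one_notin_extended_ideal:
  assumes p: "ideal p (ring_of_ints K)" "1 \<notin> p"
    and pq: "ideal_prod CC p q = principal_ideal K a" and "a \<noteq> 0" "a \<in> K" "q \<subseteq> K"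
  shows "1 \<notin> extended_ideal p"
proof
  assume "1 \<in> extended_ideal p"
  hence q: "q \<subseteq> principal_ideal K a"
    using subset_principal_ideal_if_one_mem_extended_ideal assms(3-6) by blast
  have "ideal_prod CC p q \<subseteq> (\<lambda>x. x * a) ` p"
  proof (rule ideal_prod_CC_subset)
    fix i b assume "i \<in> p" "b \<in> q"
    then obtain r where r: "r \<in> \<O>\<^bsub>K\<^esub>" "b = r * a"
      using q mem_principal_ideal_iff by blast
    hence "i * b = (i * r) * a" by simp
    thus "i * b \<in> (\<lambda>x. x * a) ` p"
      using K.ideal_mult_right[OF p(1) r(1) \<open>i \<in> p\<close>] by blast
  next
    fix x y assume "x \<in> (\<lambda>x. x * a) ` p" "y \<in> (\<lambda>x. x * a) ` p"
    thus "x + y \<in> (\<lambda>x. x * a) ` p"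
      using K.ideal_add[OF p(1)] by (auto simp flip: distrib_right)
  qed
  hence "a \<in> (\<lambda>x. x * a) ` p"
    using K.self_mem_principal_ideal[of a] by (auto simp: pq)
  thus False
    using p(2) \<open>a \<noteq> 0\<close> by auto
qed

lemma primes_above_nonempty:
  fixes l :: int
  assumes p: "p \<in> nonzero_primes K" and l: "prime l" "of_int l \<in> p"
    and "ideal_prod CC p q = principal_ideal K a" and "a \<noteq> 0" "a \<in> K" "q \<subseteq> K"
  shows "primes_above K L p \<noteq> {}"
proof -
  have prime_p: "primeideal p (ring_of_ints K)"
    using p by (simp add: nonzero_primes_def)
  note ideal_p = K.primeideal_is_ideal[OF prime_p]
  have "1 \<notin> extended_ideal p"
    using one_notin_extended_ideal[OF ideal_p K.one_notin_primeideal[OF prime_p] assms(4-7)] .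
  then obtain P where max: "maximalideal P (ring_of_ints L)" and P: "extended_ideal p \<subseteq> P"
    using L.ints.exists_maximalideal[OF extended_ideal_is_ideal[OF ideal_p]] by auto
  have prime: "primeideal P (ring_of_ints L)"
    by (rule L.ints.maximalideal_prime[OF max])
  have "p \<subseteq> extended_ideal p"
    using ideal_prod_CC_mult[OF L.ints_one] by fastforce
  hence p_subset: "p \<subseteq> P \<inter> K"
    using P K.ideal_subset_ints[OF ideal_p] ints_subset_field[of K] by blast
  have "P \<inter> K = p"
    using maximalideal.I_maximal[OF K.maximalideal_if_primeideal[OF prime_p l], of "P \<inter> K"]
      primeideal_contract[OF prime] K.primeideal_is_ideal K.ideal_subset_ints p_subset
      K.one_notin_primeideal K.ints_one by metis
  moreover have "P \<noteq> {0}"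
    using p_subset l by auto
  ultimately show ?thesis
    using prime by (auto simp: primes_above_def nonzero_primes_def)
qed

end

sublocale galois_subextension \<subseteq> intermediate: complex_extension M L
  using intermediate_subset by unfold_locales

context galois_subextension
begin

lemma primes_above_contract:
  assumes "P \<in> primes_above K L p" and "p \<in> nonzero_primes K"
  shows "P \<inter> M \<in> primes_above K M p"
proof -
  have P: "primeideal P (ring_of_ints L)" "P \<inter> K = p"
    using assms(1) by (auto simp: primes_above_def nonzero_primes_def)
  have "(P \<inter> M) \<inter> K = p"
    using P(2) M.base_subset by blast
  moreover from this have "P \<inter> M \<noteq> {0}"
    using assms(2) K.zero_mem by (auto simp: nonzero_primes_def)
  ultimately show ?thesis
    using intermediate.primeideal_contract[OF P(1)]
    by (simp add: primes_above_def nonzero_primes_def)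
qed

lemma frobenius_at_restrict:
  assumes frob: "frobenius_at K L p P \<tau>"
  shows "frobenius_at K M p (P \<inter> M) (restrict \<tau> M)"
  unfolding frobenius_at_def
proof (intro conjI ballI)
  have \<tau>: "\<tau> \<in> carrier (Gal K L)"
    using frob by (simp add: frobenius_at_def)
  show "restrict \<tau> M \<in> carrier (Gal K M)"
    by (rule restrict_Gal[OF \<tau>])
  fix a assume a: "a \<in> \<O>\<^bsub>M\<^esub>"
  hence "a \<in> M" "a \<in> \<O>\<^bsub>L\<^esub>"
    using intermediate_subset by (auto simp: mem_ints_iff)
  thus "restrict \<tau> M a - a ^ ideal_norm K p \<in> P \<inter> M"
    using frob Gal_maps_galois_subextension[OF \<tau>] by (simp add: frobenius_at_def)
qed

lemma artin_symbol_restrict: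
  assumes \<tau>: "is_artin_symbol K L p \<tau>" and \<rho>: "is_artin_symbol K M p \<rho>"
    and "p \<in> nonzero_primes K" and "primes_above K L p \<noteq> {}"
  shows "restrict \<tau> M = \<rho>"
proof -
  obtain P where P: "P \<in> primes_above K L p"
    using assms(4) by blast
  hence "frobenius_at K L p P \<tau>"
    using \<tau> by (simp add: is_artin_symbol_def)
  thus ?thesis
    using frobenius_at_restrict \<rho> primes_above_contract[OF P assms(3)]
    unfolding is_artin_symbol_def by blast
qed

end

lemma class_field_galois: "class_field K m H L \<Longrightarrow> galois_extension K L"
  by (simp add: class_field_def abelian_extension_def)

context complex_subfield
begin

lemma class_field_artin_symbol_pow:
  assumes m: "ideal m (ring_of_ints K)" and L: "class_field K m H L"
    and p: "p \<in> nonzero_primes K" "comaximal K p m"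
  obtains \<rho> where "is_artin_symbol K L p \<rho>"
    "\<And>k :: nat. \<rho> [^]\<^bsub>Gal K L\<^esub> k = \<one>\<^bsub>Gal K L\<^esub> \<longleftrightarrow> ideal_power K p k \<in> H"
proof -
  from L obtain \<Phi> where hom: "\<Phi> \<in> hom (ideal_group K m) (Gal K L)"
    and artin: "is_artin_symbol K L p (\<Phi> p)"
    and kernel: "kernel (ideal_group K m) (Gal K L) \<Phi> = H"
    using p by (auto simp: class_field_def)
  interpret comm_group "Gal K L"
    using L by (simp add: class_field_def abelian_extension_def)
  have ideal_p: "ideal p (ring_of_ints K)" and "p \<noteq> {0}"
    using p(1) primeideal_is_ideal by (auto simp: nonzero_primes_def)
  hence mem: "ideal_power K p k \<in> carrier (ideal_group K m)" for k
    by (intro ideal_in_ideal_group m ideal_power_is_ideal comaximal_ideal_power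
        ideal_power_ne_zero p(2))
  have "\<Phi> (ideal_power K p k) = \<Phi> p [^]\<^bsub>Gal K L\<^esub> k" for k :: nat
  proof (induction k)
    case 0
    have "\<Phi> \<O>\<^bsub>K\<^esub> \<otimes>\<^bsub>Gal K L\<^esub> \<Phi> \<O>\<^bsub>K\<^esub> = \<Phi> \<O>\<^bsub>K\<^esub>" "\<Phi> \<O>\<^bsub>K\<^esub> \<in> carrier (Gal K L)"
      using hom_mult[OF hom mem[of 0] mem[of 0]] hom_in_carrier[OF hom mem[of 0]]
      by (simp_all add: ideal_ints_prod ideal_ints)
    thus ?case by (simp add: l_cancel_one)
  next
    case (Suc k)
    have "p \<in> carrier (ideal_group K m)"
      by (rule ideal_in_ideal_group[OF m ideal_p \<open>p \<noteq> {0}\<close> p(2)])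
    thus ?case
      using hom_mult[OF hom mem[of k]] Suc.IH by simp
  qed
  thus ?thesis
    using that[of "\<Phi> p"] artin mem by (simp add: kernel_def flip: kernel)
qed

lemma artin_symbol_compositum_pow_eq_one_iff:
  fixes k :: nat
  assumes M: "ideal m (ring_of_ints K)" "class_field K m H M"
    and N: "ideal m' (ring_of_ints K)" "class_field K m' H' N"
    and p: "p \<in> nonzero_primes K" "comaximal K p m" "comaximal K p m'"
    and \<tau>: "is_artin_symbol K (compositum M N) p \<tau>" "primes_above K (compositum M N) p \<noteq> {}"
  shows "\<tau> [^]\<^bsub>Gal K (compositum M N)\<^esub> k = \<one>\<^bsub>Gal K (compositum M N)\<^esub> \<longleftrightarrow>
    ideal_power K p k \<in> H \<and> ideal_power K p k \<in> H'"
proof -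
  let ?L = "compositum M N"
  have galois: "galois_extension K M" "galois_extension K N"
    using M(2) N(2) class_field_galois by blast+
  interpret M: galois_subextension K ?L M
    by (rule galois_subextension_compositum[OF galois])
  interpret N: galois_subextension K ?L N
    by (rule galois_subextension_compositum[OF galois])
  obtain \<rho> where \<rho>: "is_artin_symbol K M p \<rho>"
    "\<And>k :: nat. \<rho> [^]\<^bsub>Gal K M\<^esub> k = \<one>\<^bsub>Gal K M\<^esub> \<longleftrightarrow> ideal_power K p k \<in> H"
    using class_field_artin_symbol_pow[OF M p(1,2)] by blast
  obtain \<omega> where \<omega>: "is_artin_symbol K N p \<omega>"
    "\<And>k :: nat. \<omega> [^]\<^bsub>Gal K N\<^esub> k = \<one>\<^bsub>Gal K N\<^esub> \<longleftrightarrow> ideal_power K p k \<in> H'"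
    using class_field_artin_symbol_pow[OF N p(1,3)] by blast
  have "\<tau> \<in> carrier (Gal K ?L)"
    using \<tau>(1) by (simp add: is_artin_symbol_def)
  hence "\<tau> [^]\<^bsub>Gal K ?L\<^esub> k = \<one>\<^bsub>Gal K ?L\<^esub> \<longleftrightarrow>
    restrict \<tau> M [^]\<^bsub>Gal K M\<^esub> k = \<one>\<^bsub>Gal K M\<^esub> \<and> restrict \<tau> N [^]\<^bsub>Gal K N\<^esub> k = \<one>\<^bsub>Gal K N\<^esub>"
    by (simp add: Gal_compositum_eq_one_iff[OF galois] M.restrict_Gal_pow N.restrict_Gal_pow)
  also have "restrict \<tau> M = \<rho>"
    by (rule M.artin_symbol_restrict[OF \<tau>(1) \<rho>(1) p(1) \<tau>(2)])
  also have "restrict \<tau> N = \<omega>"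
    by (rule N.artin_symbol_restrict[OF \<tau>(1) \<omega>(1) p(1) \<tau>(2)])
  finally show ?thesis
    by (simp only: \<rho>(2) \<omega>(2))
qed

end


subsection \<open>Imaginary quadratic fields\<close>

lemma cnj_Rats: "a \<in> \<rat> \<Longrightarrow> cnj a = a"
  by (erule Rats_cases') simp

locale imag_quadratic =
  fixes d :: int and K :: "complex set"
  assumes d_pos: "d > 0" and K_eq: "K = quadratic_field (- d)"
begin

sublocale complex_subfield K
  unfolding K_eq quadratic_field_def by (rule complex_subfield_generate_field)

definition \<theta> :: complex
  where "\<theta> = csqrt (of_int (- d))"

lemma theta_square: "\<theta> * \<theta> = of_int (- d)"
  unfolding \<theta>_def by (metis power2_csqrt power2_eq_square)

lemma cnj_theta: "cnj \<theta> = - \<theta>"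
  using d_pos by (simp add: \<theta>_def)

lemma theta_mem_ints: "\<theta> \<in> \<O>\<^bsub>K\<^esub>"
  unfolding mem_ints_iff
proof
  show "\<theta> \<in> K"
    unfolding K_eq quadratic_field_def \<theta>_def by (rule generate_field.incl) simp
  show "algebraic_int \<theta>"
    unfolding \<theta>_def by (intro algebraic_int_csqrt int_imp_algebraic_int Ints_of_int)
qed

definition rational_combinations :: "complex set"
  where "rational_combinations = {a + b * \<theta> | a b. a \<in> \<rat> \<and> b \<in> \<rat>}"

lemma rational_combinationsI: "a \<in> \<rat> \<Longrightarrow> b \<in> \<rat> \<Longrightarrow> a + b * \<theta> \<in> rational_combinations"
  by (auto simp: rational_combinations_def)

lemma rational_combinationsE:
  assumes "x \<in> rational_combinations"
  obtains a b where "a \<in> \<rat>" "b \<in> \<rat>" "x = a + b * \<theta>"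
  using assms by (auto simp: rational_combinations_def)

lemma rational_combinations_mult:
  assumes "x \<in> rational_combinations" and "y \<in> rational_combinations"
  shows "x * y \<in> rational_combinations"
proof -
  obtain a b where x: "a \<in> \<rat>" "b \<in> \<rat>" "x = a + b * \<theta>"
    using rational_combinationsE[OF assms(1)] .
  obtain a' b' where y: "a' \<in> \<rat>" "b' \<in> \<rat>" "y = a' + b' * \<theta>"
    using rational_combinationsE[OF assms(2)] .
  have "x * y = (a * a' + b * b' * (\<theta> * \<theta>)) + (a * b' + b * a') * \<theta>"
    by (simp add: x(3) y(3) algebra_simps)
  thus ?thesis
    using x(1,2) y(1,2) unfolding theta_square
    by (simp add: rational_combinationsI)
qed

lemma rational_combinations_inverse:
  assumes "x \<in> rational_combinations"
  shows "inverse x \<in> rational_combinations"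
proof -
  obtain a b where x: "a \<in> \<rat>" "b \<in> \<rat>" "x = a + b * \<theta>"
    using rational_combinationsE[OF assms] .
  define N where "N = a * a + b * b * of_int d"
  have cnj: "cnj x = a - b * \<theta>"
    using x by (simp add: cnj_Rats cnj_theta)
  have "x * cnj x = a * a - b * b * (\<theta> * \<theta>)"
    unfolding cnj by (simp add: x(3) algebra_simps)
  hence norm: "x * cnj x = N"
    by (simp add: N_def theta_square)
  have "inverse x = cnj x / (x * cnj x)"
    by (cases "x = 0") (simp_all add: inverse_eq_divide)
  also have "\<dots> = a / N + (- b / N) * \<theta>"
    unfolding norm by (simp add: cnj diff_divide_distrib)
  also have "\<dots> \<in> rational_combinations"
    using x(1,2) unfolding N_def by (intro rational_combinationsI) simp_all
  finally show ?thesis .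
qed

lemma quadratic_field_subset: "K \<subseteq> rational_combinations"
proof
  fix x assume "x \<in> K"
  hence "x \<in> generate_field CC {\<theta>}"
    by (simp add: K_eq quadratic_field_def \<theta>_def)
  thus "x \<in> rational_combinations"
  proof induction
    case one
    show ?case using rational_combinationsI[of 1 0] by simp
  next
    case (incl x)
    thus ?case using rational_combinationsI[of 0 1] by simp
  next
    case (a_inv x)
    thus ?case using rational_combinations_mult[OF rational_combinationsI[of "- 1" 0]] by simp
  next
    case (m_inv x)
    thus ?case using rational_combinations_inverse by simp
  next
    case (eng_add x y)
    then obtain a b a' b' where "a \<in> \<rat>" "b \<in> \<rat>" "x = a + b * \<theta>"
      "a' \<in> \<rat>" "b' \<in> \<rat>" "y = a' + b' * \<theta>"
      by (metis rational_combinationsE)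
    thus ?case using rational_combinationsI[of "a + a'" "b + b'"] by (simp add: algebra_simps)
  next
    case (eng_mult x y)
    thus ?case using rational_combinations_mult by simp
  qed
qed

lemma
  assumes "x \<in> K"
  shows cnj_mem: "cnj x \<in> K" and trace_Rats: "x + cnj x \<in> \<rat>" and norm_Rats: "x * cnj x \<in> \<rat>"
proof -
  obtain a b where a: "a \<in> \<rat>" and b: "b \<in> \<rat>" and x: "x = a + b * \<theta>"
    using quadratic_field_subset assms rational_combinationsE by blast
  have cnj: "cnj x = a - b * \<theta>"
    using a b by (simp add: x cnj_Rats cnj_theta)
  show "cnj x \<in> K"
    using a b theta_mem_ints by (simp add: cnj Rats_mem mem_ints_iff)
  have "x + cnj x = a + a"
    unfolding cnj by (simp add: x)
  thus "x + cnj x \<in> \<rat>"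
    using a by (metis Rats_add)
  have "x * cnj x = a * a - b * b * (\<theta> * \<theta>)"
    unfolding cnj by (simp add: x algebra_simps)
  also have "\<dots> \<in> \<rat>"
    unfolding theta_square using a b by (intro Rats_diff Rats_mult Rats_of_int)
  finally show "x * cnj x \<in> \<rat>" .
qed

lemma cnj_mem_ints [simp]: "x \<in> \<O>\<^bsub>K\<^esub> \<Longrightarrow> cnj x \<in> \<O>\<^bsub>K\<^esub>"
  by (simp add: mem_ints_iff cnj_mem)

lemma trace_int:
  assumes "x \<in> \<O>\<^bsub>K\<^esub>"
  obtains t :: int where "x + cnj x = of_int t"
proof -
  have "x + cnj x \<in> \<O>\<^bsub>K\<^esub>" "x + cnj x \<in> \<rat>"
    using assms trace_Rats by (simp, simp add: mem_ints_iff)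
  thus ?thesis
    using that rational_algebraic_int_is_int by (auto simp: mem_ints_iff elim: Ints_cases)
qed

lemma norm_int:
  assumes "x \<in> \<O>\<^bsub>K\<^esub>"
  obtains n :: int where "x * cnj x = of_int n" "n \<ge> 0"
proof -
  have "x * cnj x \<in> \<O>\<^bsub>K\<^esub>" "x * cnj x \<in> \<rat>"
    using assms norm_Rats by (simp, simp add: mem_ints_iff)
  then obtain n :: int where n: "x * cnj x = of_int n"
    using rational_algebraic_int_is_int by (auto simp: mem_ints_iff elim: Ints_cases)
  hence "of_real (of_int n) = (of_real ((cmod x)\<^sup>2) :: complex)"
    using complex_norm_square[of x] by simp
  hence "real_of_int n = (cmod x)\<^sup>2"
    by (simp only: of_real_eq_iff)
  hence "n \<ge> 0"
    by (metis of_int_0_le_iff zero_le_power2)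
  thus ?thesis
    using that n by blast
qed

lemma norm_unit:
  assumes "u \<in> \<O>\<^bsub>K\<^esub>" and "v \<in> \<O>\<^bsub>K\<^esub>" and "u * v = 1"
  shows "u * cnj u = 1"
proof -
  obtain a where a: "u * cnj u = of_int a" "a \<ge> 0" using norm_int[OF assms(1)] .
  obtain b where b: "v * cnj v = of_int b" using norm_int[OF assms(2)] .
  have "of_int (a * b) = (u * v) * cnj (u * v)"
    by (simp flip: a(1) b)
  hence "a * b = 1"
    unfolding assms(3) by (simp flip: of_int_mult)
  thus ?thesis
    using a zmult_eq_1_iff[of a b] by auto
qed

lemma cnj_mem_ideal_power:
  assumes "\<And>x. x \<in> I \<Longrightarrow> cnj x \<in> J" and "x \<in> ideal_power K I k"
  shows "cnj x \<in> ideal_power K J k"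
  using assms(2)
proof (induction k arbitrary: x)
  case (Suc k)
  have "x \<in> ideal_prod CC (ideal_power K I k) I"
    using Suc.prems by simp
  hence "cnj x \<in> ideal_prod CC (ideal_power K J k) J"
    by induction (simp_all add: Suc.IH assms(1) ideal_prod_CC_mult ideal_prod_CC_add)
  thus ?case by simp
qed simp

text \<open>
  One of \<open>\<theta> - c\<close> and \<open>\<theta> + c\<close> lies in \<open>p\<close>; if \<open>p\<close> is its own conjugate, so does \<open>2 c\<close>.
\<close>
lemma cnj_primeideal_ne:
  fixes q c :: int
  assumes p: "primeideal p (ring_of_ints K)" and q: "of_int q \<in> p"
    and sqrt: "[- d = c ^ 2] (mod q)" and "coprime q (2 * c)"
  shows "cnj ` p \<noteq> p"
proof
  assume cnj_p: "cnj ` p = p"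
  note ideal_p = primeideal_is_ideal[OF p]
  obtain e where e: "- d - c ^ 2 = e * q"
    using sqrt by (metis cong_iff_dvd_diff dvd_def mult.commute)
  have "(\<theta> - of_int c) * (\<theta> + of_int c) = of_int (- d - c ^ 2)"
    using theta_square by (simp add: algebra_simps power2_eq_square)
  also have "\<dots> \<in> p"
    unfolding e using ideal_mult_left[OF ideal_p ints_of_int q] by simp
  finally have "\<theta> - of_int c \<in> p \<or> \<theta> + of_int c \<in> p"
    using primeideal_mult[OF p, of "\<theta> - of_int c" "\<theta> + of_int c"] theta_mem_ints by simp
  then obtain c' :: int where c': "\<theta> - of_int c' \<in> p" "c' = c \<or> c' = - c"
    by (metis diff_minus_eq_add of_int_minus)
  have "cnj (\<theta> - of_int c') \<in> p"
    using c'(1) cnj_p by blast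
  hence "of_int (2 * c') \<in> p"
    using ideal_uminus[OF ideal_p ideal_add[OF ideal_p c'(1)], of "cnj (\<theta> - of_int c')"]
    by (simp add: cnj_theta)
  moreover have "coprime q (2 * c')"
    using assms(4) c'(2) by auto
  ultimately have "comaximal K p p"
    using comaximal_if_coprime_ints[OF ideal_p ideal_p q] by blast
  thus False
    using comaximal_iff[OF ideal_p ideal_p] ideal_add[OF ideal_p] one_notin_primeideal[OF p]
    by metis
qed

end


subsection \<open>The discriminant and units\<close>

locale imag_quadratic_of_disc = imag_quadratic +
  fixes D :: int
  assumes disc: "imag_quadratic_disc K D"
begin

lemma disc_mod_4: "D mod 4 = 0 \<or> D mod 4 = 1"
proof -
  obtain w1 w2 where
    bij: "bij_betw (\<lambda>(a :: int, b :: int). of_int a * w1 + of_int b * w2) UNIV \<O>\<^bsub>K\<^esub>"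
    and D: "of_int D = (w1 * cnj w2 - w2 * cnj w1)\<^sup>2"
    using disc by (auto simp: imag_quadratic_disc_def)
  have "w1 \<in> \<O>\<^bsub>K\<^esub>" "w2 \<in> \<O>\<^bsub>K\<^esub>"
    using bij_betw_apply[OF bij, of "(1, 0)"] bij_betw_apply[OF bij, of "(0, 1)"] by simp_all
  then obtain t n m where
    "w1 * cnj w2 + cnj (w1 * cnj w2) = of_int t" "w1 * cnj w1 = of_int n" "w2 * cnj w2 = of_int m"
    by (metis trace_int norm_int cnj_mem_ints ints_mult)
  moreover have "(w1 * cnj w2 - w2 * cnj w1)\<^sup>2 =
    (w1 * cnj w2 + cnj (w1 * cnj w2))\<^sup>2 - 4 * (w1 * cnj w1) * (w2 * cnj w2)"
    by (simp add: power2_eq_square algebra_simps)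
  ultimately have "of_int D = (of_int (t\<^sup>2 - 4 * n * m) :: complex)"
    using D by simp
  hence "D = t\<^sup>2 - 4 * (n * m)"
    by (simp only: of_int_eq_iff mult.assoc)
  moreover have "\<exists>k. t\<^sup>2 = 4 * k \<or> t\<^sup>2 = 4 * k + 1"
  proof (cases "even t")
    case True
    then obtain b where "t = 2 * b" by (rule evenE)
    thus ?thesis by (intro exI[of _ "b * b"]) (simp add: power2_eq_square)
  next
    case False
    then obtain b where "t = 2 * b + 1" by (rule oddE)
    thus ?thesis by (intro exI[of _ "b * b + b"]) (simp add: power2_eq_square algebra_simps)
  qed
  ultimately show ?thesis
    by presburger
qed

lemma ints_coords:
  obtains \<delta> where "\<delta> * \<delta> = of_int D" "cnj \<delta> = - \<delta>"
    "\<And>w. w \<in> \<O>\<^bsub>K\<^esub> \<Longrightarrow> \<exists>t m :: int. w = (of_int t + of_int m * \<delta>) / 2"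
proof -
  obtain w1 w2 where
    bij: "bij_betw (\<lambda>(a :: int, b :: int). of_int a * w1 + of_int b * w2) UNIV \<O>\<^bsub>K\<^esub>"
    and D: "of_int D = (w1 * cnj w2 - w2 * cnj w1)\<^sup>2"
    using disc by (auto simp: imag_quadratic_disc_def)
  define \<delta> where "\<delta> = w1 * cnj w2 - w2 * cnj w1"
  have basis: "\<exists>a b :: int. w = of_int a * w1 + of_int b * w2" if "w \<in> \<O>\<^bsub>K\<^esub>" for w
    using that unfolding bij_betw_imp_surj_on[OF bij, symmetric] by auto
  obtain a b :: int where one: "1 = of_int a * w1 + of_int b * w2"
    using basis[OF ints_one] by blast
  have cnj_one: "1 = of_int a * cnj w1 + of_int b * cnj w2"
    using arg_cong[OF one, of cnj] by simp
  have "\<exists>t m :: int. w = (of_int t + of_int m * \<delta>) / 2" if w: "w \<in> \<O>\<^bsub>K\<^esub>" for w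
  proof -
    obtain u v :: int where uv: "w = of_int u * w1 + of_int v * w2" using basis[OF w] by blast
    obtain t where t: "w + cnj w = of_int t" using trace_int[OF w] .
    have "w - cnj w = w * 1 - cnj w * 1" by simp
    also have "\<dots> = w * (of_int a * cnj w1 + of_int b * cnj w2)
        - cnj w * (of_int a * w1 + of_int b * w2)"
      by (simp only: flip: one cnj_one)
    also have "\<dots> = of_int (u * b - v * a) * \<delta>"
      by (simp add: uv \<delta>_def algebra_simps)
    finally have "2 * w = of_int t + of_int (u * b - v * a) * \<delta>"
      unfolding t[symmetric] by (simp add: algebra_simps)
    hence "w = (of_int t + of_int (u * b - v * a) * \<delta>) / 2"
      by (simp add: mult.commute)
    thus ?thesis by blast
  qed
  moreover have "\<delta> * \<delta> = of_int D" "cnj \<delta> = - \<delta>"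
    using D by (simp_all add: \<delta>_def power2_eq_square)
  ultimately show ?thesis using that by blast
qed

lemma eq_one_or_minus_one_if_norm_one:
  assumes "D < - 4" and u: "u \<in> \<O>\<^bsub>K\<^esub>" "u * cnj u = 1"
  shows "u = 1 \<or> u = - 1"
proof -
  obtain \<delta> where \<delta>: "\<delta> * \<delta> = of_int D" "cnj \<delta> = - \<delta>"
    "\<And>w. w \<in> \<O>\<^bsub>K\<^esub> \<Longrightarrow> \<exists>t m :: int. w = (of_int t + of_int m * \<delta>) / 2"
    using ints_coords by blast
  obtain t m :: int where tm: "u = (of_int t + of_int m * \<delta>) / 2"
    using \<delta>(3)[OF u(1)] by blast
  have "4 * (u * cnj u) = of_int t * of_int t - of_int m * of_int m * (\<delta> * \<delta>)"
    by (simp add: tm \<delta>(2) field_simps)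
  hence "of_int 4 = (of_int (t * t - m * m * D) :: complex)"
    unfolding u(2) \<delta>(1) by simp
  hence eq: "t * t - m * m * D = 4"
    by (simp only: of_int_eq_iff)
  have "m = 0"
  proof (rule ccontr)
    assume "m \<noteq> 0"
    hence "m * m \<ge> 1"
      by (metis int_one_le_iff_zero_less not_real_square_gt_zero zero_less_mult_iff
          linorder_neqE_linordered_idom)
    hence "m * m * D \<le> 1 * D"
      using \<open>D < - 4\<close> by (intro mult_right_mono_neg) auto
    moreover have "t * t \<ge> 0" by simp
    ultimately show False
      using eq \<open>D < - 4\<close> by linarith
  qed
  hence "(t - 2) * (t + 2) = 0"
    using eq by (simp add: algebra_simps)
  hence "t = 2 \<or> t = - 2" by auto
  thus ?thesis
    using tm \<open>m = 0\<close> by auto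
qed

lemma principal_ideal_eq_imp:
  assumes "D < - 4" and "principal_ideal K \<alpha> = principal_ideal K \<beta>" and "\<alpha> \<noteq> 0"
  shows "\<beta> = \<alpha> \<or> \<beta> = - \<alpha>"
proof -
  obtain u v where u: "u \<in> \<O>\<^bsub>K\<^esub>" "\<beta> = u * \<alpha>" and v: "v \<in> \<O>\<^bsub>K\<^esub>" "\<alpha> = v * \<beta>"
    using assms(2) self_mem_principal_ideal[of \<alpha>] self_mem_principal_ideal[of \<beta>]
    by (metis mem_principal_ideal_iff)
  have "(u * v) * \<alpha> = \<alpha>"
    using u(2) v(2) by (metis mult.assoc mult.commute)
  hence "u * v = 1"
    using \<open>\<alpha> \<noteq> 0\<close> by (metis mult_cancel_right1)
  hence "u = 1 \<or> u = - 1"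
    using eq_one_or_minus_one_if_norm_one[OF assms(1) u(1)] norm_unit u(1) v(1) by blast
  thus ?thesis
    using u(2) by auto
qed

lemma mem_ray_and_ring_subgroup_iff:
  assumes "D < - 4" and m: "ideal m (ring_of_ints K)"
    and I: "ideal I (ring_of_ints K)" "I \<noteq> {0}" "comaximal K I (principal_ideal K (of_nat f))"
  shows "I \<in> ray_subgroup K m \<and> I \<in> ring_subgroup K f \<longleftrightarrow>
    (\<exists>\<alpha>\<in>quadratic_order K f. I = principal_ideal K \<alpha> \<and> (\<alpha> - 1 \<in> m \<or> \<alpha> + 1 \<in> m))"
  unfolding mem_ray_subgroup_iff[OF m I(1,2)] mem_ring_subgroup_iff_quadratic_order[OF I]
proof
  assume "(\<exists>\<alpha>. I = principal_ideal K \<alpha> \<and> \<alpha> - 1 \<in> m) \<and>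
    (\<exists>\<alpha>\<in>quadratic_order K f. I = principal_ideal K \<alpha>)"
  then obtain \<alpha> \<beta> where \<alpha>: "I = principal_ideal K \<alpha>" "\<alpha> - 1 \<in> m"
    and \<beta>: "\<beta> \<in> quadratic_order K f" "I = principal_ideal K \<beta>"
    by blast
  have "\<alpha> \<noteq> 0"
    using I(2) \<alpha>(1) principal_ideal_zero by auto
  hence "\<beta> = \<alpha> \<or> \<beta> = - \<alpha>"
    using principal_ideal_eq_imp[OF \<open>D < - 4\<close>] \<alpha>(1) \<beta>(2) by blast
  hence "\<beta> - 1 \<in> m \<or> \<beta> + 1 \<in> m"
    using \<alpha>(2) ideal_uminus[OF m \<alpha>(2)] by auto
  thus "\<exists>\<alpha>\<in>quadratic_order K f. I = principal_ideal K \<alpha> \<and> (\<alpha> - 1 \<in> m \<or> \<alpha> + 1 \<in> m)"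
    using \<beta> by blast
next
  assume "\<exists>\<alpha>\<in>quadratic_order K f. I = principal_ideal K \<alpha> \<and> (\<alpha> - 1 \<in> m \<or> \<alpha> + 1 \<in> m)"
  then obtain \<alpha> where \<alpha>: "\<alpha> \<in> quadratic_order K f" "I = principal_ideal K \<alpha>"
    "\<alpha> - 1 \<in> m \<or> - \<alpha> - 1 \<in> m"
    using ideal_uminus[OF m] by (metis minus_add_distrib uminus_add_conv_diff add.commute)
  thus "(\<exists>\<alpha>. I = principal_ideal K \<alpha> \<and> \<alpha> - 1 \<in> m) \<and>
    (\<exists>\<alpha>\<in>quadratic_order K f. I = principal_ideal K \<alpha>)"
    using principal_ideal_uminus by metis
qed

lemma quadratic_order_coords:
  assumes "- d = D * int f ^ 2" and "\<alpha> \<in> quadratic_order K f"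
  obtains x y :: int where "\<alpha> = (of_int x + of_int y * \<theta>) / 2"
proof -
  obtain \<delta> where \<delta>: "\<delta> * \<delta> = of_int D"
    "\<And>w. w \<in> \<O>\<^bsub>K\<^esub> \<Longrightarrow> \<exists>t m :: int. w = (of_int t + of_int m * \<delta>) / 2"
    using ints_coords by blast
  obtain a w where w: "\<alpha> = of_int a + of_nat f * w" "w \<in> \<O>\<^bsub>K\<^esub>"
    using assms(2) by (auto simp: quadratic_order_def)
  obtain t m :: int where tm: "w = (of_int t + of_int m * \<delta>) / 2"
    using \<delta>(2)[OF w(2)] by blast
  have "(of_nat f * \<delta>) * (of_nat f * \<delta>) = of_int (D * int f ^ 2)"
    by (simp add: \<delta>(1)[symmetric] power2_eq_square mult_ac)
  hence "of_nat f * \<delta> = \<theta> \<or> of_nat f * \<delta> = - \<theta>"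
    unfolding assms(1)[symmetric] theta_square[symmetric] by (simp only: square_eq_iff)
  then obtain e :: int where e: "of_nat f * \<delta> = of_int e * \<theta>"
    by (metis mult_minus1 mult_1 of_int_1 of_int_minus)
  have "\<alpha> = (of_int (2 * a + int f * t) + of_int m * (of_nat f * \<delta>)) / 2"
    by (simp add: w(1) tm field_simps)
  also have "\<dots> = (of_int (2 * a + int f * t) + of_int (m * e) * \<theta>) / 2"
    unfolding e by simp
  finally show ?thesis using that by blast
qed

end


subsection \<open>Split primes\<close>

locale conjugate_prime_pair = imag_quadratic +
  fixes q :: int and p p' :: "complex set"
  assumes prime_q: "prime q"
    and p_nonzero_prime: "p \<in> nonzero_primes K" and p'_nonzero_prime: "p' \<in> nonzero_primes K"
    and p'_eq_cnj: "p' = cnj ` p"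
    and principal_ideal_q: "principal_ideal K (of_int q) = ideal_prod CC p p'"
begin

lemma prime_p: "primeideal p (ring_of_ints K)" and prime_p': "primeideal p' (ring_of_ints K)"
  using p_nonzero_prime p'_nonzero_prime by (auto simp: nonzero_primes_def)

lemmas ideal_p = primeideal_is_ideal[OF prime_p]
lemmas ideal_p' = primeideal_is_ideal[OF prime_p']

lemma q_mem_p: "of_int q \<in> p" and q_mem_p': "of_int q \<in> p'"
  using self_mem_principal_ideal[of "of_int q"] ints.ideal_prod_inter[OF ideal_p ideal_p']
  by (auto simp: principal_ideal_q ideal_prod_ring_of_ints)

end

locale split_prime = conjugate_prime_pair +
  assumes p_ne_p': "p \<noteq> p'"
begin

lemma comaximal_p_p': "comaximal K p p'"
  using maximalideal_if_primeideal[OF prime_p prime_q q_mem_p]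
    maximalideal_if_primeideal[OF prime_p' prime_q q_mem_p'] p_ne_p'
  by (rule comaximal_if_distinct_maximalideals)

lemma cnj_mem_p_power: "x \<in> ideal_power K p k \<Longrightarrow> cnj x \<in> ideal_power K p' k"
  and cnj_mem_p'_power: "x \<in> ideal_power K p' k \<Longrightarrow> cnj x \<in> ideal_power K p k"
  by (rule cnj_mem_ideal_power; auto simp: p'_eq_cnj)+

lemma p_power_inter_p'_power:
  "ideal_power K p k \<inter> ideal_power K p' k = principal_ideal K (of_int (q ^ k))"
proof -
  have "ideal_power K p k \<inter> ideal_power K p' k =
    ideal_prod CC (ideal_power K p k) (ideal_power K p' k)"
    using ints.ideal_prod_eq_inter[of "ideal_power K p k" "ideal_power K p' k"]
      ideal_power_is_ideal ideal_p ideal_p'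
      comaximal_ideal_powers[OF ideal_p ideal_p' comaximal_p_p']
    by (simp add: comaximal_def ideal_prod_ring_of_ints)
  also have "\<dots> = ideal_power K (principal_ideal K (of_int q)) k"
    using ideals.nat_pow_distrib[of p p' k] ideal_p ideal_p' by (simp add: principal_ideal_q)
  finally show ?thesis
    by (simp add: principal_ideal_power)
qed

lemma dvd_if_of_int_mem_p'_power:
  assumes "of_int x \<in> ideal_power K p' k"
  shows "q ^ k dvd x"
proof -
  have "of_int x \<in> ideal_power K p k \<inter> ideal_power K p' k"
    using assms cnj_mem_p'_power[OF assms] by simp
  then obtain r where "r \<in> \<O>\<^bsub>K\<^esub>" "of_int x = of_int (q ^ k) * r"
    unfolding p_power_inter_p'_power mem_principal_ideal_iff by (auto simp: mult.commute)
  thus ?thesis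
    using of_int_dvd_if_algebraic_int[of x "q ^ k" r] by (simp add: mem_ints_iff)
qed

lemma trace_cong_mod:
  assumes "\<alpha> \<in> ideal_power K p k" and "\<alpha> - of_int c \<in> ideal_power K p' k"
    and "\<alpha> + cnj \<alpha> = of_int x"
  shows "[x = c] (mod q ^ k)"
proof -
  have "(\<alpha> - of_int c) + cnj \<alpha> \<in> ideal_power K p' k"
    using ideal_add[OF ideal_power_is_ideal[OF ideal_p']] assms(2) cnj_mem_p_power[OF assms(1)] .
  also have "(\<alpha> - of_int c) + cnj \<alpha> = of_int (x - c)"
    using assms(3) by (simp add: algebra_simps)
  finally show ?thesis
    using dvd_if_of_int_mem_p'_power by (simp add: cong_iff_dvd_diff)
qed

end


subsection \<open>Powers of a prime above 3\<close>

locale three_splits_order =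
  conjugate_prime_pair d K 3 p p' + imag_quadratic_of_disc d K D
  for d K p p' D +
  fixes f :: nat
  assumes d_eq: "- d = D * int f ^ 2" and d_cong: "[- d = 1] (mod 3)"
begin

sublocale split_prime d K 3 p p'
proof
  show "p \<noteq> p'"
    using cnj_primeideal_ne[OF prime_p q_mem_p, of 1] d_cong p'_eq_cnj by auto
qed

abbreviation modulus :: "complex set"
  where "modulus \<equiv> ideal_power K p' 2"

definition admissible_generator :: "nat \<Rightarrow> complex \<Rightarrow> bool"
  where "admissible_generator k \<alpha> \<longleftrightarrow> \<alpha> \<in> quadratic_order K f \<and>
    ideal_power K p k = principal_ideal K \<alpha> \<and> (\<alpha> - 1 \<in> modulus \<or> \<alpha> + 1 \<in> modulus)"

lemma coprime_3_f: "coprime 3 (int f)"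
proof -
  have "coprime (- d) 3"
    using cong_imp_coprime[OF cong_sym[OF d_cong]] by simp
  thus ?thesis
    unfolding d_eq by (simp add: coprime_commute)
qed

lemma disc_less_minus_4: "D < - 4"
proof -
  have "\<not> 3 dvd int f"
    using coprime_3_f coprime_absorb_left[of 3 "int f"] by auto
  hence "int f mod 3 = 1 \<or> int f mod 3 = 2"
    by presburger
  hence "[int f ^ 2 = 1] (mod 3)"
    by (auto simp: cong_def power_mod[symmetric, of "int f"])
  hence "[D * int f ^ 2 = D * 1] (mod 3)"
    by (rule cong_scalar_left)
  hence "D mod 3 = 1"
    using d_cong unfolding d_eq by (simp add: cong_def)
  moreover have "D * int f ^ 2 < 0"
    using d_pos d_eq by simp
  hence "D < 0"
    by (simp add: mult_less_0_iff)
  ultimately show ?thesis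
    using disc_mod_4 by presburger
qed

lemma comaximal_p_f: "comaximal K p (principal_ideal K (of_nat f))"
  using coprime_3_f q_mem_p
  by (intro comaximal_if_coprime_ints[of _ _ 3 "int f"] ideal_p ideal_principal_ideal) simp_all

lemma comaximal_p_modulus: "comaximal K p modulus"
proof -
  have "ideal_power K p 1 = p"
    using ideals.nat_pow_eone[of p] ideal_p by simp
  thus ?thesis
    using comaximal_ideal_powers[OF ideal_p ideal_p' comaximal_p_p'] by metis
qed

lemma artin_symbol_pow_eq_one_iff:
  fixes k :: nat
  assumes \<Sigma>: "is_ray_class_field K modulus \<Sigma>" and \<Omega>: "is_ring_class_field K f \<Omega>"
    and \<tau>: "is_artin_symbol K (compositum \<Sigma> \<Omega>) p \<tau>"
  shows "\<tau> [^]\<^bsub>Gal K (compositum \<Sigma> \<Omega>)\<^esub> k = \<one>\<^bsub>Gal K (compositum \<Sigma> \<Omega>)\<^esub> \<longleftrightarrow>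
    (\<exists>\<alpha>. admissible_generator k \<alpha>)"
proof -
  let ?L = "compositum \<Sigma> \<Omega>" and ?I = "ideal_power K p k"
  interpret L: galois_subextension K ?L \<Sigma>
    using \<Sigma> \<Omega> by (intro galois_subextension_compositum)
      (auto simp: is_ray_class_field_def is_ring_class_field_def intro: class_field_galois)
  have ideals: "ideal modulus (ring_of_ints K)"
    "ideal (principal_ideal K (of_nat f)) (ring_of_ints K)"
    by (simp_all add: ideal_power_is_ideal[OF ideal_p'] ideal_principal_ideal)
  have "primes_above K ?L p \<noteq> {}"
    using L.primes_above_nonempty[OF p_nonzero_prime prime_q q_mem_p principal_ideal_q[symmetric]]
      ideal_subset_ints[OF ideal_p'] ints_subset_field[of K] by auto
  hence "\<tau> [^]\<^bsub>Gal K ?L\<^esub> k = \<one>\<^bsub>Gal K ?L\<^esub> \<longleftrightarrow>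
    ?I \<in> ray_subgroup K modulus \<and> ?I \<in> ring_subgroup K f"
    using \<Sigma> \<Omega> \<tau> ideals p_nonzero_prime comaximal_p_modulus comaximal_p_f
    unfolding is_ray_class_field_def is_ring_class_field_def
    by (intro artin_symbol_compositum_pow_eq_one_iff)
  also have "\<dots> \<longleftrightarrow> (\<exists>\<alpha>. admissible_generator k \<alpha>)"
    unfolding admissible_generator_def Bex_def[symmetric]
    using p_nonzero_prime ideal_p ideal_p' comaximal_p_f
    by (intro mem_ray_and_ring_subgroup_iff disc_less_minus_4 ideal_power_is_ideal
        ideal_power_ne_zero comaximal_ideal_power ideals) (simp_all add: nonzero_primes_def)
  finally show ?thesis .
qed

lemma admissible_generator_coords:
  assumes "admissible_generator k \<alpha>" and "k \<ge> 2"
  obtains x y :: int where "\<alpha> = (of_int x + of_int y * \<theta>) / 2" "[x = 1] (mod 9) \<or> [x = - 1] (mod 9)"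
proof -
  obtain x y :: int where xy: "\<alpha> = (of_int x + of_int y * \<theta>) / 2"
    using quadratic_order_coords[OF d_eq] assms(1) by (auto simp: admissible_generator_def)
  have "\<alpha> \<in> ideal_power K p k"
    using assms(1) self_mem_principal_ideal by (simp add: admissible_generator_def)
  hence "\<alpha> \<in> ideal_power K p 2"
    using ideal_power_antimono[OF ideal_p \<open>k \<ge> 2\<close>] by blast
  moreover have "\<alpha> + cnj \<alpha> = of_int x"
    by (simp add: xy cnj_theta field_simps)
  moreover have "\<alpha> - of_int 1 \<in> modulus \<or> \<alpha> - of_int (- 1) \<in> modulus"
    using assms(1) by (simp add: admissible_generator_def)
  ultimately have "[x = 1] (mod 3 ^ 2) \<or> [x = - 1] (mod 3 ^ 2)"
    using trace_cong_mod by blast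
  thus ?thesis
    using that xy by simp
qed

end

theorem theorem4:
  fixes d dK :: int and f n :: nat
    and K \<Omega> \<Sigma> p3 p3' :: "complex set"
    and \<tau> :: "complex \<Rightarrow> complex"
  assumes "d > 0"
    and "K = quadratic_field (- d)"
    and "imag_quadratic_disc K dK"
    and "f > 0"
    and "- d = dK * int f ^ 2"
    and "[- d = 1] (mod 3)"
    and "p3 \<in> nonzero_primes K" and "p3' \<in> nonzero_primes K"
    and "p3' = cnj ` p3"
    and "cgenideal (ring_of_ints K) 3 = ideal_prod (ring_of_ints K) p3 p3'"
    and "is_ring_class_field K f \<Omega>"
    and "is_ray_class_field K (p3' [^]\<^bsub>ideals_set (ring_of_ints K)\<^esub> (2 :: nat)) \<Sigma>"
    and "is_artin_symbol K (compositum \<Sigma> \<Omega>) p3 \<tau>"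
    and "group.ord (Gal K (compositum \<Sigma> \<Omega>)) \<tau> = n"
    and "n \<ge> 2"
  shows "is_arg_min (\<lambda>k. k)
    (\<lambda>k :: nat. k > 0 \<and>
      (\<exists>(x :: int) (y :: int) \<alpha>.
         \<alpha> = (of_int x + of_int y * csqrt (of_int (- d))) / 2 \<and>
         p3 [^]\<^bsub>ideals_set (ring_of_ints K)\<^esub> k = cgenideal (ring_of_ints K) \<alpha> \<and>
         \<alpha> \<in> quadratic_order K f \<and>
         ([x = 1] (mod 9) \<or> [x = -1] (mod 9)) \<and>
         (\<alpha> - 1 \<in> p3' [^]\<^bsub>ideals_set (ring_of_ints K)\<^esub> (2 :: nat) \<or>
          \<alpha> + 1 \<in> p3' [^]\<^bsub>ideals_set (ring_of_ints K)\<^esub> (2 :: nat)))) n"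
proof -
  interpret three_splits_order d K p3 p3' dK f
    using assms by unfold_locales (simp_all add: ideal_prod_ring_of_ints)
  interpret galois_subextension K "compositum \<Sigma> \<Omega>" \<Sigma>
    using assms(11,12) class_field_galois unfolding is_ring_class_field_def is_ray_class_field_def
    by (blast intro: galois_subextension_compositum)
  have \<tau>: "\<tau> \<in> carrier (Gal K (compositum \<Sigma> \<Omega>))"
    using assms(13) by (simp add: is_artin_symbol_def)
  have n_dvd_iff: "n dvd k \<longleftrightarrow> (\<exists>\<alpha>. admissible_generator k \<alpha>)" for k
    using artin_symbol_pow_eq_one_iff[OF assms(12,11,13)] Gal.pow_eq_id[OF \<tau>] assms(14) by simp
  obtain \<alpha> where \<alpha>: "admissible_generator n \<alpha>"
    using n_dvd_iff[of n] by auto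
  moreover obtain x y :: int where "\<alpha> = (of_int x + of_int y * \<theta>) / 2"
    "[x = 1] (mod 9) \<or> [x = - 1] (mod 9)"
    using admissible_generator_coords[OF \<alpha> \<open>n \<ge> 2\<close>] .
  moreover have "\<not> k < n" if "k > 0" "admissible_generator k \<beta>" for k \<beta>
    using that n_dvd_iff[of k] by (auto dest: dvd_imp_le)
  ultimately show ?thesis
    using \<open>n \<ge> 2\<close> unfolding is_arg_min_def admissible_generator_def \<theta>_def
    by (intro conjI) (simp, blast, blast)
qed

end
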